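(* Let $K$ be a field and let $H=(H^0,H^1,s,r)$ be a connected hypergraph such that $|s(h)|\geq 2$ and $|r(h)|\geq 2$ for any $h\in H^1$. Then the Leavitt path algebra $L_K(H)$ is semiprimitive, i.e. its Jacobson radical is the zero ideal.
   Context: Algebras are associative but not necessarily unital. A multiset over a set $Y$ is a function $M:Y\to\mathbb N_0$; its support is $M_{\mathrm{supp}}=\{y\in Y\mid M(y)>0\}$. $\mathrm{Mult}(Y)$ is the set of multisets over $Y$ with finite, nonempty support, and $|M|=\sum_{y\in M_{\mathrm{supp}}}M(y)$. A (directed) hypergraph is a quadruple $H=(H^0,H^1,s,r)$ where $H^0,H^1$ are sets and $s,r:H^1\to\mathrm{Mult}(H^0)$ are maps. All hypergraphs are assumed nonempty (not $H^0=H^1=\emptyset$). For each $h\in H^1$ fix listings with multiplicity $s(h)=\{s(h)_1,\dots,s(h)_{|s(h)|}\}$ and $r(h)=\{r(h)_1,\dots,r(h)_{|r(h)|}\}$. The Leavitt path algebra $L_K(H)$ is the (not necessarily unital) $K$-algebra presented by the generators $v,h_{ij},h_{ij}^*$ ($v\in H^0$, $h\in H^1$, $1\le i\le|s(h)|$, $1\le j\le|r(h)|$) and the relations: (i) $uv=\delta_{uv}u$ ($u,v\in H^0$); (ii) $s(h)_ih_{ij}=h_{ij}=h_{ij}r(h)_j$ and $r(h)_jh_{ij}^*=h_{ij}^*=h_{ij}^*s(h)_i$ for all $h,i,j$; (iii) $\sum_{k=1}^{|r(h)|}h_{ik}h_{jk}^*=\delta_{ij}s(h)_i$ ($h\in H^1$,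 $1\le i,j\le|s(h)|$); (iv) $\sum_{k=1}^{|s(h)|}h_{ki}^*h_{kj}=\delta_{ij}r(h)_i$ ($h\in H^1$, $1\le i,j\le|r(h)|$). Let $\hat E$ be the directed graph with vertex set $H^0$ and edges all $h_{ij}$ (with source $s(h)_i$ and range $r(h)_j$) and all $h_{ij}^*$ (with source $r(h)_j$ and range $s(h)_i$). $H$ is connected if for any $v,w\in H^0$ there is a (possibly trivial) directed path in $\hat E$ from $v$ to $w$. The Jacobson radical of a not necessarily unital ring $R$ is its largest ideal all of whose elements $x$ are left quasi-regular (there is $y\in R$ with $x+y=yx$). *)

theory Defs
  imports
    "HOL-Library.Multiset"
    "HOL-Library.Poly_Mapping"
    "HOL-Algebra.QuotRing"
    "HOL-Algebra.Module"
    "Graph_Theory.Arc_Walk"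
begin

section \<open>Hypergraphs\<close>

record ('v, 'e) hypergraph =
  hverts :: "'v set"
  hedges :: "'e set"
  src :: "'e \<Rightarrow> 'v multiset"
  rng :: "'e \<Rightarrow> 'v multiset"

locale hypergraph =
  fixes H :: "('v, 'e) hypergraph"
  assumes src_nonempty: "h \<in> hedges H \<Longrightarrow> src H h \<noteq> {#}"
    and src_verts: "h \<in> hedges H \<Longrightarrow> set_mset (src H h) \<subseteq> hverts H"
    and rng_nonempty: "h \<in> hedges H \<Longrightarrow> rng H h \<noteq> {#}"
    and rng_verts: "h \<in> hedges H \<Longrightarrow> set_mset (rng H h) \<subseteq> hverts H"
    and nonempty: "\<not> (hverts H = {} \<and> hedges H = {})"

text \<open>
  The source and range of a hyperedge \<open>h\<close> are enumerated, with multiplicity, by lists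
  \<open>\<sigma> h\<close> and \<open>\<rho> h\<close>. Positions are counted from \<open>0\<close>, so \<open>\<sigma> h ! i\<close> is $s(h)_{i+1}$.
\<close>

definition listings ::
  "('v, 'e) hypergraph \<Rightarrow> ('e \<Rightarrow> 'v list) \<Rightarrow> ('e \<Rightarrow> 'v list) \<Rightarrow> bool" where
  "listings H \<sigma> \<rho> \<longleftrightarrow> (\<forall>h\<in>hedges H. mset (\<sigma> h) = src H h \<and> mset (\<rho> h) = rng H h)"

text \<open>\<open>Fwd h i j\<close> stands for $h_{ij}$ and \<open>Bwd h i j\<close> for $h_{ij}^*$.\<close>

datatype 'e edge = Fwd 'e nat nat | Bwd 'e nat nat

definition edges :: "('v, 'e) hypergraph \<Rightarrow> 'e edge set" where
  "edges H =
     {Fwd h i j | h i j. h \<in> hedges H \<and> i < size (src H h) \<and> j < size (rng H h)} \<union>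
     {Bwd h i j | h i j. h \<in> hedges H \<and> i < size (src H h) \<and> j < size (rng H h)}"

definition edge_digraph ::
  "('v, 'e) hypergraph \<Rightarrow> ('e \<Rightarrow> 'v list) \<Rightarrow> ('e \<Rightarrow> 'v list) \<Rightarrow> ('v, 'e edge) pre_digraph" where
  "edge_digraph H \<sigma> \<rho> =
     \<lparr>verts = hverts H,
      arcs = edges H,
      tail = (\<lambda>e. case e of Fwd h i j \<Rightarrow> \<sigma> h ! i | Bwd h i j \<Rightarrow> \<rho> h ! j),
      head = (\<lambda>e. case e of Fwd h i j \<Rightarrow> \<rho> h ! j | Bwd h i j \<Rightarrow> \<sigma> h ! i)\<rparr>"

definition hconnected ::
  "('v, 'e) hypergraph \<Rightarrow> ('e \<Rightarrow> 'v list) \<Rightarrow> ('e \<Rightarrow> 'v list) \<Rightarrow> bool" where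
  "hconnected H \<sigma> \<rho> \<longleftrightarrow>
     (\<forall>v\<in>hverts H. \<forall>w\<in>hverts H. \<exists>p. pre_digraph.awalk (edge_digraph H \<sigma> \<rho>) v p w)"


section \<open>Non-unital rings and algebras\<close>

text \<open>
  A ring or algebra without unit is given by a record of type \<^typ>\<open>'a ring\<close> or
  \<^typ>\<open>('k, 'a) module\<close> whose field \<^const>\<open>one\<close> is ignored: it need not lie in the carrier,
  and no definition below refers to it. The locale \<^locale>\<open>ideal\<close> presupposes a unital ring, so
  two-sided ideals are defined afresh.
\<close>

definition ring_ideal :: "'a set \<Rightarrow> ('a, 'm) ring_scheme \<Rightarrow> bool" where
  "ring_ideal I R \<longleftrightarrow>
     additive_subgroup I R \<and>
     (\<forall>x\<in>I. \<forall>a\<in>carrier R. a \<otimes>\<^bsub>R\<^esub> x \<in> I \<and> x \<otimes>\<^bsub>R\<^esub> a \<in> I)"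

definition left_quasi_regular :: "('a, 'm) ring_scheme \<Rightarrow> 'a \<Rightarrow> bool" where
  "left_quasi_regular R x \<longleftrightarrow> (\<exists>y\<in>carrier R. x \<oplus>\<^bsub>R\<^esub> y = y \<otimes>\<^bsub>R\<^esub> x)"

definition jacobson_radical :: "('a, 'm) ring_scheme \<Rightarrow> 'a set" where
  "jacobson_radical R = (GREATEST J. ring_ideal J R \<and> (\<forall>x\<in>J. left_quasi_regular R x))"

definition semiprimitive :: "('a, 'm) ring_scheme \<Rightarrow> bool" where
  "semiprimitive R \<longleftrightarrow> jacobson_radical R = {\<zero>\<^bsub>R\<^esub>}"

text \<open>
  Without a unit, a ring ideal need not be closed under scalars, so this has to be required of
  the ideals by which algebras are divided.
\<close>

definition algebra_ideal :: "'a set \<Rightarrow> ('k, 'a) module \<Rightarrow> bool" where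
  "algebra_ideal I A \<longleftrightarrow> ring_ideal I A \<and> (\<forall>c. \<forall>x\<in>I. c \<odot>\<^bsub>A\<^esub> x \<in> I)"

definition gen_algebra_ideal :: "('k, 'a) module \<Rightarrow> 'a set \<Rightarrow> 'a set" where
  "gen_algebra_ideal A S = \<Inter> {I. algebra_ideal I A \<and> S \<subseteq> I}"

definition quot_algebra :: "('k, 'a) module \<Rightarrow> 'a set \<Rightarrow> ('k, 'a set) module" where
  "quot_algebra A I =
     ring.extend (A Quot I) (module.fields (\<lambda>c X. \<Union>x\<in>X. I +>\<^bsub>A\<^esub> (c \<odot>\<^bsub>A\<^esub> x)))"


section \<open>Free non-unital algebras\<close>

datatype 'x word = Word (letters: "'x list")

instantiation word :: (type) monoid_add
begin

definition zero_word :: "'a word" where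
  "0 = Word []"

definition plus_word :: "'a word \<Rightarrow> 'a word \<Rightarrow> 'a word" where
  "u + v = Word (letters u @ letters v)"

instance
  by standard (simp_all add: zero_word_def plus_word_def)

end

text \<open>
  With concatenation as the addition of words, \<open>'x word \<Rightarrow>\<^sub>0 'k\<close> carries the multiplication of
  the free unital algebra. The free non-unital algebra on \<open>X\<close> consists of the linear
  combinations of nonempty words over \<open>X\<close>.
\<close>

definition free_algebra :: "'x set \<Rightarrow> ('k :: field, 'x word \<Rightarrow>\<^sub>0 'k) module" where
  "free_algebra X =
     \<lparr>carrier = {p. \<forall>w\<in>Poly_Mapping.keys p. letters w \<noteq> [] \<and> set (letters w) \<subseteq> X},
      mult = (*),
      one = 1,
      zero = 0,
      add = (+),
      smult = (\<lambda>c. Poly_Mapping.map ((*) c))\<rparr>"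

definition gen :: "'x \<Rightarrow> 'x word \<Rightarrow>\<^sub>0 'k :: field" where
  "gen x = Poly_Mapping.single (Word [x]) 1"


section \<open>Leavitt path algebras\<close>

datatype ('v, 'e) generator = Vert 'v | Edge "'e edge"

definition generators :: "('v, 'e) hypergraph \<Rightarrow> ('v, 'e) generator set" where
  "generators H = Vert ` hverts H \<union> Edge ` edges H"

type_synonym ('v, 'e, 'k) free_lpa = "('v, 'e) generator word \<Rightarrow>\<^sub>0 'k"

abbreviation gvert :: "'v \<Rightarrow> ('v, 'e, 'k :: field) free_lpa" where
  "gvert v \<equiv> gen (Vert v)"

abbreviation gfwd :: "'e \<Rightarrow> nat \<Rightarrow> nat \<Rightarrow> ('v, 'e, 'k :: field) free_lpa" where
  "gfwd h i j \<equiv> gen (Edge (Fwd h i j))"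

abbreviation gbwd :: "'e \<Rightarrow> nat \<Rightarrow> nat \<Rightarrow> ('v, 'e, 'k :: field) free_lpa" where
  "gbwd h i j \<equiv> gen (Edge (Bwd h i j))"

text \<open>A relation $a = b$ is represented by the element $a - b$.\<close>

definition vertex_relations :: "('v, 'e) hypergraph \<Rightarrow> ('v, 'e, 'k :: field) free_lpa set" where
  "vertex_relations H =
     {gvert u * gvert v - (if u = v then gvert u else 0) | u v. u \<in> hverts H \<and> v \<in> hverts H}"

definition edge_relations ::
  "('v, 'e) hypergraph \<Rightarrow> ('e \<Rightarrow> 'v list) \<Rightarrow> ('e \<Rightarrow> 'v list) \<Rightarrow>
    ('v, 'e, 'k :: field) free_lpa set" where
  "edge_relations H \<sigma> \<rho> =
     (\<Union>h\<in>hedges H. \<Union>i\<in>{..<size (src H h)}. \<Union>j\<in>{..<size (rng H h)}.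
        {gvert (\<sigma> h ! i) * gfwd h i j - gfwd h i j,
         gfwd h i j * gvert (\<rho> h ! j) - gfwd h i j,
         gvert (\<rho> h ! j) * gbwd h i j - gbwd h i j,
         gbwd h i j * gvert (\<sigma> h ! i) - gbwd h i j})"

definition source_relations ::
  "('v, 'e) hypergraph \<Rightarrow> ('e \<Rightarrow> 'v list) \<Rightarrow> ('v, 'e, 'k :: field) free_lpa set" where
  "source_relations H \<sigma> =
     {(\<Sum>k<size (rng H h). gfwd h i k * gbwd h j k) - (if i = j then gvert (\<sigma> h ! i) else 0)
        | h i j. h \<in> hedges H \<and> i < size (src H h) \<and> j < size (src H h)}"

definition range_relations ::
  "('v, 'e) hypergraph \<Rightarrow> ('e \<Rightarrow> 'v list) \<Rightarrow> ('v, 'e, 'k :: field) free_lpa set" where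
  "range_relations H \<rho> =
     {(\<Sum>k<size (src H h). gbwd h k i * gfwd h k j) - (if i = j then gvert (\<rho> h ! i) else 0)
        | h i j. h \<in> hedges H \<and> i < size (rng H h) \<and> j < size (rng H h)}"

definition leavitt_path_algebra ::
  "('v, 'e) hypergraph \<Rightarrow> ('e \<Rightarrow> 'v list) \<Rightarrow> ('e \<Rightarrow> 'v list) \<Rightarrow>
    ('k :: field, ('v, 'e, 'k) free_lpa set) module" where
  "leavitt_path_algebra H \<sigma> \<rho> =
     (let F = free_algebra (generators H)
      in quot_algebra F (gen_algebra_ideal F
           (vertex_relations H \<union> edge_relations H \<sigma> \<rho> \<union> source_relations H \<sigma> \<union> range_relations H \<rho>)))"

end

theory Submission
  imports Defs
begin

text \<open>
  Mark one index in the source and one in the range of every hyperedge and use (iii) and (iv) to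
  eliminate the products of edges that meet at a marked index. The irreducible paths then form a
  basis: this rewriting defines an action on the combinations of such paths that satisfies all
  relations. The marks are arbitrary, and since all sources and ranges have at least two elements
  they can avoid both indices of any given edge $e$. Multiplication of a path by $e$ is then plain
  concatenation, so $ex \<noteq> 0$ whenever $x \<noteq> 0$ begins at the head of $e$. By connectedness, an
  ideal that contains a nonzero element contains a nonzero $x \<in> vLv$, where $v$ is the head of some
  edge $e$ (unless there are no edges, when the algebra is one-dimensional). Suppose that
  $y = e x e^*$ is left quasi-regular. Products $zy$ are concatenations of paths, and $y + z = zy$
  turns into $(1 - z)(1 - y) = 1$ in a free algebra, which is impossible because $1 - y$ has
  positive degree there.
\<close>

section \<open>Linear extension\<close>

text \<open>Independence of the irreducible paths is obtained without a confluence argument: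
  elements of the defining ideal act as zero on them, whereas \<open>x\<close> sends the vertex
  \<open>v\<close> to a combination of paths congruent to the product of \<open>x\<close> and
  \<open>v\<close>. Hence congruent elements have the same normal form. A path carries its end as a
  closing vertex letter, so that the span of the paths ending at \<open>v\<close> models the left
  ideal L v and the trivial path is a nonempty word. Deleting the letter leads to the free unital
  algebra, where an equation with 1 makes sense. The shape of y answers to the three junctions in z
  e x e^*. The first is at the tail index of e, the other two are at its head index, so unmarked
  indices of e keep all of them free of rewriting, whatever x and z are. The last factor returns to
  the tail v0 of e: the z that is added and the z that multiplies y are then both read off from z
  v0, while e x alone would pair z v with z v0. The ideal is defined before any marks are chosen, so
  separate arguments about it may use separate marks.\<close>

abbreviation mon :: "'x list \<Rightarrow> 'x word \<Rightarrow>\<^sub>0 'k :: field" where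
  "mon w \<equiv> Poly_Mapping.single (Word w) 1"

text \<open>Scalars act as multiplication by a constant (\<open>0\<close> is the empty word), so the
  ring laws cover them.\<close>

abbreviation scale :: "'k \<Rightarrow> ('x word \<Rightarrow>\<^sub>0 'k) \<Rightarrow> 'x word \<Rightarrow>\<^sub>0 'k :: field" where
  "scale c f \<equiv> Poly_Mapping.single 0 c * f"

lemma lookup_scale: "Poly_Mapping.lookup (scale c f) k = c * Poly_Mapping.lookup f k"
  unfolding mult_map_scale_conv_mult[symmetric] by (simp add: map.rep_eq when_def)

lemma mon_mult: "mon u * mon v = mon (u @ v)"
  by (simp add: mult_single plus_word_def)

lemma keys_scale: "Poly_Mapping.keys (scale c f) \<subseteq> Poly_Mapping.keys f"
  by (auto simp: in_keys_iff lookup_scale)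

definition lin :: "('x list \<Rightarrow> 'y word \<Rightarrow>\<^sub>0 'k) \<Rightarrow> ('x word \<Rightarrow>\<^sub>0 'k) \<Rightarrow> 'y word \<Rightarrow>\<^sub>0 'k :: field" where
  "lin \<phi> f = (\<Sum>w\<in>Poly_Mapping.keys f. scale (Poly_Mapping.lookup f w) (\<phi> (letters w)))"

lemma lin_superset:
  assumes "finite A" "Poly_Mapping.keys f \<subseteq> A"
  shows "lin \<phi> f = (\<Sum>w\<in>A. scale (Poly_Mapping.lookup f w) (\<phi> (letters w)))"
  unfolding lin_def using assms
  by (intro sum.mono_neutral_left) (auto simp: in_keys_iff)

lemma lin_0 [simp]: "lin \<phi> 0 = 0"
  by (simp add: lin_def)

lemma lin_single [simp]: "lin \<phi> (Poly_Mapping.single w c) = scale c (\<phi> (letters w))"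
  by (cases "c = 0") (simp_all add: lin_def)

lemma lin_add: "lin \<phi> (f + g) = lin \<phi> f + lin \<phi> g"
proof -
  let ?A = "Poly_Mapping.keys f \<union> Poly_Mapping.keys g"
  have "Poly_Mapping.keys (f + g) \<subseteq> ?A"
    by (rule keys_add)
  then show ?thesis
    by (simp add: lin_superset[of ?A] lookup_add single_add distrib_right sum.distrib)
qed

lemma lin_scale: "lin \<phi> (scale c f) = scale c (lin \<phi> f)"
proof -
  have "lin \<phi> (scale c f) =
      (\<Sum>w\<in>Poly_Mapping.keys f. scale (c * Poly_Mapping.lookup f w) (\<phi> (letters w)))"
    by (simp add: lin_superset[OF _ keys_scale] lookup_scale)
  also have "\<dots> = scale c (lin \<phi> f)"
    by (simp add: lin_def sum_distrib_left mult.assoc[symmetric] mult_single)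
  finally show ?thesis .
qed

lemma lin_uminus: "lin \<phi> (- f) = - lin \<phi> f"
  by (metis add.right_inverse lin_0 lin_add minus_unique)

lemma lin_diff: "lin \<phi> (f - g) = lin \<phi> f - lin \<phi> g"
  by (metis lin_add lin_uminus uminus_add_conv_diff add.commute)

lemma lin_sum: "lin \<phi> (\<Sum>i\<in>A. f i) = (\<Sum>i\<in>A. lin \<phi> (f i))"
  by (induction A rule: infinite_finite_induct) (simp_all add: lin_add)

lemma lin_cong:
  assumes "\<And>w. w \<in> Poly_Mapping.keys f \<Longrightarrow> \<phi> (letters w) = \<psi> (letters w)"
  shows "lin \<phi> f = lin \<psi> f"
  using assms by (simp add: lin_def)

lemma lookup_lin:
  "Poly_Mapping.lookup (lin \<phi> f) k =
    (\<Sum>w\<in>Poly_Mapping.keys f. Poly_Mapping.lookup f w * Poly_Mapping.lookup (\<phi> (letters w)) k)"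
  by (simp add: lin_def lookup_sum lookup_scale)

lemma lin_mon: "lin mon f = f"
proof (rule poly_mapping_eqI)
  fix k
  have "Poly_Mapping.lookup (lin mon f) k =
      (\<Sum>w\<in>Poly_Mapping.keys f. if w = k then Poly_Mapping.lookup f w else 0)"
    unfolding lookup_lin by (rule sum.cong) (auto simp: lookup_single when_def)
  also have "\<dots> = Poly_Mapping.lookup f k"
    by (simp add: in_keys_iff)
  finally show "Poly_Mapping.lookup (lin mon f) k = Poly_Mapping.lookup f k" .
qed

text \<open>Every element equals \<open>lin mon f\<close>, so identities that are linear in an
  argument need checking only on words.\<close>

lemma poly_linear_induct [case_names add scale mon]:
  assumes "\<And>f g. P f \<Longrightarrow> P g \<Longrightarrow> P (f + g)"
    and "\<And>c f. P f \<Longrightarrow> P (scale c f)"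
    and "\<And>w. P (mon w)"
  shows "P (f :: 'x word \<Rightarrow>\<^sub>0 'k :: field)"
proof -
  have "P 0"
    using assms(2)[OF assms(3), of 0] by simp
  moreover have scaled: "P (scale (Poly_Mapping.lookup f w) (mon (letters w)))" for w
    by (intro assms)
  have "finite A \<Longrightarrow> P (\<Sum>w\<in>A. scale (Poly_Mapping.lookup f w) (mon (letters w)))" for A
    by (induction A rule: finite_induct) (simp_all only: sum.empty sum.insert not_False_eq_True assms(1) scaled \<open>P 0\<close>)
  ultimately have "P (lin mon f)"
    unfolding lin_def by simp
  then show ?thesis
    by (simp add: lin_mon)
qed

text \<open>Constants are central although words do not commute: the empty word commutes with every
  word.\<close>

lemma scale_mult_right: "f * scale c g = scale c (f * g)"
proof -
  have "f * Poly_Mapping.single 0 c = scale c f"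
    by (induction f rule: poly_linear_induct)
      (simp_all add: distrib_left distrib_right mult.assoc mult_single mult.commute,
       simp add: mult.assoc[symmetric] mult_single mult.commute)
  then show ?thesis
    by (metis mult.assoc)
qed

lemma lin_mult_left: "g * lin \<phi> f = lin (\<lambda>w. g * \<phi> w) f"
  by (simp add: lin_def sum_distrib_left scale_mult_right)

lemma lin_mult_right: "lin \<phi> f * g = lin (\<lambda>w. \<phi> w * g) f"
  by (simp add: lin_def sum_distrib_right mult.assoc)

lemma lin_fun_add: "lin (\<lambda>w. \<phi> w + \<psi> w) f = lin \<phi> f + lin \<psi> f"
  by (simp add: lin_def distrib_left sum.distrib)

lemma lin_fun_diff: "lin (\<lambda>w. \<phi> w - \<psi> w) f = lin \<phi> f - lin \<psi> f"
  by (simp add: lin_def right_diff_distrib sum_subtractf)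

lemma lin_fun_scale: "lin (\<lambda>w. scale c (\<phi> w)) f = scale c (lin \<phi> f)"
  by (simp add: lin_mult_left)

lemma lin_mon_mult: "lin (\<lambda>w. mon w * g) f = f * g"
  by (simp add: lin_mult_right[symmetric] lin_mon)

definition supported :: "('x list \<Rightarrow> bool) \<Rightarrow> ('x word \<Rightarrow>\<^sub>0 'k :: field) \<Rightarrow> bool" where
  "supported P f \<longleftrightarrow> (\<forall>w\<in>Poly_Mapping.keys f. P (letters w))"

lemma supported_0 [simp]: "supported P 0"
  by (simp add: supported_def)

lemma supported_single: "P (letters w) \<Longrightarrow> supported P (Poly_Mapping.single w c)"
  by (simp add: supported_def)

lemma supported_add: "supported P f \<Longrightarrow> supported P g \<Longrightarrow> supported P (f + g)"
  using keys_add[of f g] by (auto simp: supported_def)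

lemma supported_diff: "supported P f \<Longrightarrow> supported P g \<Longrightarrow> supported P (f - g)"
  using keys_diff[of f g] by (auto simp: supported_def)

lemma supported_scale: "supported P f \<Longrightarrow> supported P (scale c f)"
  using keys_scale[of c f] by (auto simp: supported_def)

lemma supported_sum: "(\<And>i. i \<in> A \<Longrightarrow> supported P (f i)) \<Longrightarrow> supported P (\<Sum>i\<in>A. f i)"
  by (induction A rule: infinite_finite_induct) (auto intro: supported_add)

lemma supported_lin:
  "supported P f \<Longrightarrow> (\<And>w. P w \<Longrightarrow> supported Q (\<phi> w)) \<Longrightarrow> supported Q (lin \<phi> f)"
  unfolding lin_def by (intro supported_sum supported_scale) (metis supported_def)

lemma supported_mult:
  assumes "supported P f" "supported Q g" "\<And>u v. P u \<Longrightarrow> Q v \<Longrightarrow> R (u @ v)"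
  shows "supported R (f * g)"
  unfolding supported_def
proof
  fix w
  assume "w \<in> Poly_Mapping.keys (f * g)"
  then obtain u v where "u \<in> Poly_Mapping.keys f" "v \<in> Poly_Mapping.keys g" "w = u + v"
    using keys_mult[of f g] by blast
  with assms show "R (letters w)"
    by (auto simp: supported_def plus_word_def)
qed

section \<open>Degrees in the free algebra\<close>

lemma lookup_mult_keys:
  fixes f g :: "'x word \<Rightarrow>\<^sub>0 'k :: field"
  shows "Poly_Mapping.lookup (f * g) w = (\<Sum>u\<in>Poly_Mapping.keys f. \<Sum>v\<in>Poly_Mapping.keys g.
    if u + v = w then Poly_Mapping.lookup f u * Poly_Mapping.lookup g v else 0)"
proof -
  have "f * g = lin (\<lambda>u. lin (\<lambda>v. mon u * mon v) g) f"
    by (simp add: lin_mult_left[symmetric] lin_mon lin_mon_mult)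
  also have "Poly_Mapping.lookup \<dots> w = (\<Sum>u\<in>Poly_Mapping.keys f. \<Sum>v\<in>Poly_Mapping.keys g.
    if u + v = w then Poly_Mapping.lookup f u * Poly_Mapping.lookup g v else 0)"
    unfolding lookup_lin sum_distrib_left
    by (intro sum.cong refl) (auto simp: mult_single lookup_single when_def)
  finally show ?thesis .
qed

lemma longest_key:
  assumes "f \<noteq> 0"
  obtains p where "p \<in> Poly_Mapping.keys f"
    "\<And>u. u \<in> Poly_Mapping.keys f \<Longrightarrow> length (letters u) \<le> length (letters p)"
proof -
  have "Poly_Mapping.keys f \<noteq> {}"
    using assms by simp
  then show thesis
    using that obtains_MAX[OF finite_keys, of f "\<lambda>u. length (letters u)"]
    by (metis Max_ge finite_imageI finite_keys imageI)
qed

text \<open>As \<open>u\<close> is at most as long as \<open>p\<close> and \<open>v\<close> at most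
  as long as \<open>q\<close>, the equation \<open>u + v = p + q\<close> cuts both words at the same
  place. The coefficient of \<open>p + q\<close> is therefore a single product, which nothing
  cancels.\<close>

lemma longest_key_mult:
  fixes f g :: "'x word \<Rightarrow>\<^sub>0 'k :: field"
  assumes p: "p \<in> Poly_Mapping.keys f"
      "\<And>u. u \<in> Poly_Mapping.keys f \<Longrightarrow> length (letters u) \<le> length (letters p)"
    and q: "q \<in> Poly_Mapping.keys g"
      "\<And>v. v \<in> Poly_Mapping.keys g \<Longrightarrow> length (letters v) \<le> length (letters q)"
  shows "p + q \<in> Poly_Mapping.keys (f * g)"
proof -
  have "u + v = p + q \<longleftrightarrow> u = p \<and> v = q"
    if uv: "u \<in> Poly_Mapping.keys f" "v \<in> Poly_Mapping.keys g" for u v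
  proof
    assume *: "u + v = p + q"
    then have "letters u @ letters v = letters p @ letters q"
      by (simp add: plus_word_def)
    moreover from this have "length (letters u) + length (letters v) = length (letters p) + length (letters q)"
      by (metis length_append)
    then have "length (letters u) = length (letters p)"
      using p(2)[OF uv(1)] q(2)[OF uv(2)] by simp
    ultimately show "u = p \<and> v = q"
      by (simp add: word.expand)
  qed simp
  then have "Poly_Mapping.lookup (f * g) (p + q) =
    (\<Sum>u\<in>Poly_Mapping.keys f. \<Sum>v\<in>Poly_Mapping.keys g.
      if v = q then if u = p then Poly_Mapping.lookup f u * Poly_Mapping.lookup g v else 0 else 0)"
    unfolding lookup_mult_keys by (intro sum.cong refl) auto
  also have "\<dots> = Poly_Mapping.lookup f p * Poly_Mapping.lookup g q"
    using p(1) q(1) by (simp add: sum.delta)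
  finally show ?thesis
    using p(1) q(1) by (simp add: in_keys_iff)
qed

lemma free_algebra_no_zero_divisors:
  fixes f g :: "'x word \<Rightarrow>\<^sub>0 'k :: field"
  assumes "f \<noteq> 0" "g \<noteq> 0"
  shows "f * g \<noteq> 0"
proof -
  obtain p where "p \<in> Poly_Mapping.keys f"
    "\<And>u. u \<in> Poly_Mapping.keys f \<Longrightarrow> length (letters u) \<le> length (letters p)"
    using longest_key[OF assms(1)] by blast
  moreover obtain q where "q \<in> Poly_Mapping.keys g"
    "\<And>u. u \<in> Poly_Mapping.keys g \<Longrightarrow> length (letters u) \<le> length (letters q)"
    using longest_key[OF assms(2)] by blast
  ultimately show ?thesis
    using longest_key_mult by fastforce
qed

text \<open>Longest words of the factors concatenate to a word of the product. Here that word would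
  have to be empty, although \<open>g\<close> contains a nonempty one.\<close>

lemma free_algebra_not_left_invertible:
  fixes f g :: "'x word \<Rightarrow>\<^sub>0 'k :: field"
  assumes "w \<in> Poly_Mapping.keys g" "letters w \<noteq> []"
  shows "f * g \<noteq> 1"
proof
  assume 1: "f * g = 1"
  then have "f \<noteq> 0" "g \<noteq> 0"
    by auto
  obtain p where p: "p \<in> Poly_Mapping.keys f"
    "\<And>u. u \<in> Poly_Mapping.keys f \<Longrightarrow> length (letters u) \<le> length (letters p)"
    using longest_key[OF \<open>f \<noteq> 0\<close>] by blast
  obtain q where q: "q \<in> Poly_Mapping.keys g"
    "\<And>u. u \<in> Poly_Mapping.keys g \<Longrightarrow> length (letters u) \<le> length (letters q)"
    using longest_key[OF \<open>g \<noteq> 0\<close>] by blast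
  have "p + q = 0"
    using longest_key_mult[OF p q] 1 by simp
  then have "letters q = []"
    by (simp add: plus_word_def zero_word_def)
  then show False
    using q(2)[OF assms(1)] assms(2) by simp
qed

section \<open>The defining ideal\<close>

lemma carrier_free_algebra:
  "f \<in> carrier (free_algebra X) \<longleftrightarrow> supported (\<lambda>w. w \<noteq> [] \<and> set w \<subseteq> X) f"
  by (simp add: free_algebra_def supported_def)

lemma free_algebra_simps [simp]:
  "mult (free_algebra X) = (*)" "zero (free_algebra X) = 0" "add (free_algebra X) = (+)"
  "smult (free_algebra X) = scale"
  by (simp_all add: free_algebra_def fun_eq_iff mult_map_scale_conv_mult)

lemma free_algebra_closed:
  "0 \<in> carrier (free_algebra X)"
  "f \<in> carrier (free_algebra X) \<Longrightarrow> g \<in> carrier (free_algebra X) \<Longrightarrow> f + g \<in> carrier (free_algebra X)"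
  "f \<in> carrier (free_algebra X) \<Longrightarrow> g \<in> carrier (free_algebra X) \<Longrightarrow> f - g \<in> carrier (free_algebra X)"
  "f \<in> carrier (free_algebra X) \<Longrightarrow> g \<in> carrier (free_algebra X) \<Longrightarrow> f * g \<in> carrier (free_algebra X)"
  "f \<in> carrier (free_algebra X) \<Longrightarrow> scale c f \<in> carrier (free_algebra X)"
  "w \<noteq> [] \<Longrightarrow> set w \<subseteq> X \<Longrightarrow> mon w \<in> carrier (free_algebra X)"
  "(\<And>i. i \<in> A \<Longrightarrow> h i \<in> carrier (free_algebra X)) \<Longrightarrow> sum h A \<in> carrier (free_algebra X)"
  unfolding carrier_free_algebra
  by (simp_all add: supported_add supported_diff supported_scale supported_single supported_sum)
    (rule supported_mult, assumption, assumption, auto)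

lemma free_algebra_uminus_closed:
  "f \<in> carrier (free_algebra X) \<Longrightarrow> - f \<in> carrier (free_algebra X)"
  using free_algebra_closed(3)[OF free_algebra_closed(1)] by force

lemma abelian_group_free_algebra: "abelian_group (free_algebra X :: ('k :: field, _) module)"
  by (rule abelian_groupI)
    (auto simp: free_algebra_closed add_ac intro!: bexI[of _ "- _"] free_algebra_uminus_closed)

lemma a_inv_free_algebra:
  assumes "f \<in> carrier (free_algebra X)"
  shows "a_inv (free_algebra X) f = - f"
proof -
  interpret abelian_group "free_algebra X"
    by (rule abelian_group_free_algebra)
  show ?thesis
    using assms minus_equality[of "- f" f] free_algebra_uminus_closed[OF assms] by simp
qed

lemma additive_subgroup_free_algebra_iff:
  fixes J :: "('x word \<Rightarrow>\<^sub>0 'k :: field) set"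
  shows "additive_subgroup J (free_algebra X) \<longleftrightarrow>
    J \<subseteq> carrier (free_algebra X) \<and> 0 \<in> J \<and> (\<forall>x\<in>J. \<forall>y\<in>J. x + y \<in> J) \<and> (\<forall>x\<in>J. - x \<in> J)"
    (is "?l \<longleftrightarrow> ?r")
proof
  interpret abelian_group "free_algebra X :: ('k, 'x word \<Rightarrow>\<^sub>0 'k) module"
    by (rule abelian_group_free_algebra)
  {
    assume ?l
    then interpret J: additive_subgroup J "free_algebra X" .
    show ?r
    proof (intro conjI ballI)
      show "J \<subseteq> carrier (free_algebra X)"
        by (rule J.a_subset)
      show "- x \<in> J" if "x \<in> J" for x
        using J.a_inv_closed[OF that] a_inv_free_algebra[OF subsetD[OF J.a_subset that]] by simp
    qed (use J.zero_closed J.a_closed in simp_all)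
  }
  assume r: ?r
  show ?l
  proof (intro additive_subgroup.intro subgroup.intro)
    fix x assume "x \<in> J"
    moreover from this r have "x \<in> carrier (free_algebra X)"
      by blast
    ultimately show "inv\<^bsub>add_monoid (free_algebra X)\<^esub> x \<in> J"
      using r a_inv_free_algebra[of x X] by (simp add: a_inv_def)
  qed (use r in auto)
qed

text \<open>Closure under negation is absent on the right because it is scaling by -1.\<close>

lemma algebra_ideal_free_algebra_iff:
  fixes J :: "('x word \<Rightarrow>\<^sub>0 'k :: field) set"
  shows "algebra_ideal J (free_algebra X) \<longleftrightarrow>
    J \<subseteq> carrier (free_algebra X) \<and> 0 \<in> J \<and> (\<forall>x\<in>J. \<forall>y\<in>J. x + y \<in> J) \<and>
    (\<forall>x\<in>J. \<forall>a\<in>carrier (free_algebra X). a * x \<in> J \<and> x * a \<in> J) \<and> (\<forall>c. \<forall>x\<in>J. scale c x \<in> J)"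
proof -
  have "- x \<in> J" if "\<forall>c. \<forall>x\<in>J. scale c x \<in> J" "x \<in> J" for x
  proof -
    have "scale (-1) x = - x"
      by (simp add: single_uminus)
    with that show ?thesis
      by metis
  qed
  then show ?thesis
    unfolding algebra_ideal_def ring_ideal_def additive_subgroup_free_algebra_iff
    by (auto simp: fun_eq_iff)
qed

text \<open>For \<open>S\<close> inside the carrier, the carrier itself is one of the intersected
  ideals; otherwise the family would be empty and its intersection the whole type.\<close>

lemma gen_algebra_ideal_free_algebra:
  fixes S :: "('x word \<Rightarrow>\<^sub>0 'k :: field) set"
  assumes "S \<subseteq> carrier (free_algebra X)"
  shows "algebra_ideal (gen_algebra_ideal (free_algebra X) S) (free_algebra X)"
    and "S \<subseteq> gen_algebra_ideal (free_algebra X) S"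
proof -
  have "algebra_ideal (carrier (free_algebra X)) (free_algebra X :: ('k, 'x word \<Rightarrow>\<^sub>0 'k) module)"
    by (simp add: algebra_ideal_free_algebra_iff free_algebra_closed)
  with assms have *: "gen_algebra_ideal (free_algebra X) S \<subseteq> carrier (free_algebra X)"
    by (auto simp: gen_algebra_ideal_def)
  show "algebra_ideal (gen_algebra_ideal (free_algebra X) S) (free_algebra X)"
    unfolding algebra_ideal_free_algebra_iff
    using * unfolding gen_algebra_ideal_def algebra_ideal_free_algebra_iff by auto
qed (auto simp: gen_algebra_ideal_def)

lemma gen_algebra_ideal_least:
  "algebra_ideal J A \<Longrightarrow> S \<subseteq> J \<Longrightarrow> gen_algebra_ideal A S \<subseteq> J"
  by (auto simp: gen_algebra_ideal_def)

section \<open>Uniform coordinates for edges: direction, hyperedge, tail index, head index\<close>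

fun sg :: "'e edge \<Rightarrow> bool" where
  "sg (Fwd h i j) = True"
| "sg (Bwd h i j) = False"

fun hy :: "'e edge \<Rightarrow> 'e" where
  "hy (Fwd h i j) = h"
| "hy (Bwd h i j) = h"

fun li :: "'e edge \<Rightarrow> nat" where
  "li (Fwd h i j) = i"
| "li (Bwd h i j) = j"

fun ri :: "'e edge \<Rightarrow> nat" where
  "ri (Fwd h i j) = j"
| "ri (Bwd h i j) = i"

text \<open>
  With \<open>mk_edge True h i j\<close> for $h_{ij}$ and \<open>mk_edge False h j i\<close> for $h_{ij}^*$, the relations (iii)
  and (iv) take the same form, and the two indices of an edge are positions in the listings
  that contain its tail and its head.
\<close>

definition mk_edge :: "bool \<Rightarrow> 'e \<Rightarrow> nat \<Rightarrow> nat \<Rightarrow> 'e edge" where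
  "mk_edge s h i j = (if s then Fwd h i j else Bwd h j i)"

lemma mk_edge_simps [simp]:
  "sg (mk_edge s h i j) = s" "hy (mk_edge s h i j) = h"
  "li (mk_edge s h i j) = i" "ri (mk_edge s h i j) = j"
  by (simp_all add: mk_edge_def)

lemma mk_edge_eq [simp]: "mk_edge (sg e) (hy e) (li e) (ri e) = e"
  by (cases e) (simp_all add: mk_edge_def)

lemma mk_edge_inject [simp]:
  "mk_edge s h i j = mk_edge s' h' i' j' \<longleftrightarrow> s = s' \<and> h = h' \<and> i = i' \<and> j = j'"
  by (auto simp: mk_edge_def)

abbreviation gedge :: "'e edge \<Rightarrow> ('v, 'e, 'k :: field) free_lpa" where
  "gedge e \<equiv> gen (Edge e)"

locale listed_hypergraph =
  fixes H :: "('v, 'e) hypergraph" and \<sigma> \<rho> :: "'e \<Rightarrow> 'v list"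
  assumes hyp: "hypergraph H" and listings: "listings H \<sigma> \<rho>"
begin

text \<open>Edges of direction \<open>s\<close> have their tails in \<open>listing s\<close> and
  their heads in \<open>listing (\<not> s)\<close>.\<close>

definition listing :: "bool \<Rightarrow> 'e \<Rightarrow> 'v list" where
  "listing s = (if s then \<sigma> else \<rho>)"

definition etail :: "'e edge \<Rightarrow> 'v" where
  "etail e = listing (sg e) (hy e) ! li e"

definition ehead :: "'e edge \<Rightarrow> 'v" where
  "ehead e = listing (\<not> sg e) (hy e) ! ri e"

lemma etail_mk_edge [simp]: "etail (mk_edge s h i j) = listing s h ! i"
  by (simp add: etail_def)

lemma ehead_mk_edge [simp]: "ehead (mk_edge s h i j) = listing (\<not> s) h ! j"
  by (simp add: ehead_def)

lemma size_src_rng: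
  "h \<in> hedges H \<Longrightarrow> size (src H h) = length (listing True h)"
  "h \<in> hedges H \<Longrightarrow> size (rng H h) = length (listing False h)"
  using listings by (auto simp: listing_def listings_def simp flip: size_mset)

lemma mk_edge_in_edges_iff:
  "mk_edge s h i j \<in> edges H \<longleftrightarrow>
    h \<in> hedges H \<and> i < length (listing s h) \<and> j < length (listing (\<not> s) h)"
  by (cases s) (auto simp: mk_edge_def edges_def size_src_rng)

lemma in_edges_iff:
  "e \<in> edges H \<longleftrightarrow> hy e \<in> hedges H \<and> li e < length (listing (sg e) (hy e)) \<and>
    ri e < length (listing (\<not> sg e) (hy e))"
  using mk_edge_in_edges_iff[of "sg e" "hy e" "li e" "ri e"] by simp

lemma listing_in_hverts: "h \<in> hedges H \<Longrightarrow> i < length (listing s h) \<Longrightarrow> listing s h ! i \<in> hverts H"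
proof -
  assume h: "h \<in> hedges H" and i: "i < length (listing s h)"
  have "set (listing s h) = set_mset (if s then src H h else rng H h)"
    using h listings unfolding listing_def listings_def by (metis set_mset_mset)
  then show ?thesis
    using h i hypergraph.src_verts[OF hyp h] hypergraph.rng_verts[OF hyp h] nth_mem[OF i]
    by (auto split: if_splits)
qed

lemma etail_in_hverts: "e \<in> edges H \<Longrightarrow> etail e \<in> hverts H"
  by (simp add: in_edges_iff etail_def listing_in_hverts)

lemma ehead_in_hverts: "e \<in> edges H \<Longrightarrow> ehead e \<in> hverts H"
  by (simp add: in_edges_iff ehead_def listing_in_hverts)

section \<open>The relations and the ideal they generate\<close>

abbreviation F :: "('k :: field, ('v, 'e, 'k) free_lpa) module" where
  "F \<equiv> free_algebra (generators H)"

definition relations :: "('v, 'e, 'k :: field) free_lpa set" where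
  "relations = vertex_relations H \<union> edge_relations H \<sigma> \<rho> \<union> source_relations H \<sigma> \<union> range_relations H \<rho>"

definition rel_ideal :: "('v, 'e, 'k :: field) free_lpa set" where
  "rel_ideal = gen_algebra_ideal F relations"

lemma vertex_relation:
  "u \<in> hverts H \<Longrightarrow> v \<in> hverts H \<Longrightarrow> gvert u * gvert v - (if u = v then gvert u else 0) \<in> relations"
  by (auto simp: relations_def vertex_relations_def)

lemma edge_relation:
  assumes "e \<in> edges H"
  shows "gvert (etail e) * gedge e - gedge e \<in> edge_relations H \<sigma> \<rho>" (is ?tail)
    and "gedge e * gvert (ehead e) - gedge e \<in> edge_relations H \<sigma> \<rho>" (is ?head)
proof -
  have in_UN: "r \<in> edge_relations H \<sigma> \<rho>"
    if "h \<in> hedges H" "i < size (src H h)" "j < size (rng H h)"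
      and "r \<in> {gvert (\<sigma> h ! i) * gfwd h i j - gfwd h i j,
         gfwd h i j * gvert (\<rho> h ! j) - gfwd h i j,
         gvert (\<rho> h ! j) * gbwd h i j - gbwd h i j,
         gbwd h i j * gvert (\<sigma> h ! i) - gbwd h i j}" for r :: "('v, 'e, 'k :: field) free_lpa" and h i j
    unfolding edge_relations_def
    by (rule UN_I[of h], fact, rule UN_I[of i], simp add: that, rule UN_I[of j], simp add: that, fact)
  show ?tail
  proof (cases e)
    case (Fwd h i j)
    with assms show ?thesis
      by (intro in_UN[of h i j]) (auto simp: edges_def etail_def listing_def)
  next
    case (Bwd h i j)
    with assms show ?thesis
      by (intro in_UN[of h i j]) (auto simp: edges_def etail_def listing_def)
  qed
  show ?head
  proof (cases e)
    case (Fwd h i j)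
    with assms show ?thesis
      by (intro in_UN[of h i j]) (auto simp: edges_def ehead_def listing_def)
  next
    case (Bwd h i j)
    with assms show ?thesis
      by (intro in_UN[of h i j]) (auto simp: edges_def ehead_def listing_def)
  qed
qed

lemma edge_tail_relation: "e \<in> edges H \<Longrightarrow> gvert (etail e) * gedge e - gedge e \<in> relations"
  and edge_head_relation: "e \<in> edges H \<Longrightarrow> gedge e * gvert (ehead e) - gedge e \<in> relations"
  by (simp_all add: relations_def edge_relation)

lemma sum_relation:
  assumes "h \<in> hedges H" "i < length (listing s h)" "j < length (listing s h)"
  shows "(\<Sum>k<length (listing (\<not> s) h). gedge (mk_edge s h i k) * gedge (mk_edge (\<not> s) h k j)) -
    (if i = j then gvert (listing s h ! i) else 0) \<in> relations"
    (is "?r \<in> _")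
proof (cases s)
  case True
  have "?r \<in> source_relations H \<sigma>"
    unfolding source_relations_def mem_Collect_eq using assms True
    by (intro exI[of _ h] exI[of _ i] exI[of _ j])
      (simp add: mk_edge_def size_src_rng, simp add: listing_def)
  then show ?thesis
    by (simp add: relations_def)
next
  case False
  have "?r \<in> range_relations H \<rho>"
    unfolding range_relations_def mem_Collect_eq using assms False
    by (intro exI[of _ h] exI[of _ i] exI[of _ j])
      (simp add: mk_edge_def size_src_rng, simp add: listing_def)
  then show ?thesis
    by (simp add: relations_def)
qed

text \<open>Relations (iii) and (iv) are merged into the last case, \<open>s = True\<close> being
  (iii) and \<open>s = False\<close> being (iv), so that later arguments treat them
  together.\<close>

lemma relations_cases [consumes 1, case_names vertex tail head sum]:
  assumes "r \<in> relations"
  obtains u v where "u \<in> hverts H" "v \<in> hverts H"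
      "r = gvert u * gvert v - (if u = v then gvert u else 0)"
  | e where "e \<in> edges H" "r = gvert (etail e) * gedge e - gedge e"
  | e where "e \<in> edges H" "r = gedge e * gvert (ehead e) - gedge e"
  | s h i j where "h \<in> hedges H" "i < length (listing s h)" "j < length (listing s h)"
      "r = (\<Sum>k<length (listing (\<not> s) h). gedge (mk_edge s h i k) * gedge (mk_edge (\<not> s) h k j)) -
        (if i = j then gvert (listing s h ! i) else 0)"
proof -
  consider "r \<in> vertex_relations H" | "r \<in> edge_relations H \<sigma> \<rho>" | "r \<in> source_relations H \<sigma>" |
    "r \<in> range_relations H \<rho>"
    using assms by (auto simp: relations_def)
  then show thesis
  proof cases
    case 1
    then obtain u v where "u \<in> hverts H" "v \<in> hverts H"
      "r = gvert u * gvert v - (if u = v then gvert u else 0)"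
      unfolding vertex_relations_def by blast
    then show ?thesis
      by (rule that(1))
  next
    case 2
    then obtain h i j where hij: "h \<in> hedges H" "i < size (src H h)" "j < size (rng H h)"
      and r: "r = gvert (\<sigma> h ! i) * gfwd h i j - gfwd h i j \<or>
         r = gfwd h i j * gvert (\<rho> h ! j) - gfwd h i j \<or>
         r = gvert (\<rho> h ! j) * gbwd h i j - gbwd h i j \<or>
         r = gbwd h i j * gvert (\<sigma> h ! i) - gbwd h i j"
      unfolding edge_relations_def by blast
    have e: "Fwd h i j \<in> edges H" "Bwd h i j \<in> edges H"
      using hij by (auto simp: edges_def)
    have "etail (Fwd h i j) = \<sigma> h ! i" "ehead (Fwd h i j) = \<rho> h ! j"
      "etail (Bwd h i j) = \<rho> h ! j" "ehead (Bwd h i j) = \<sigma> h ! i"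
      by (simp_all add: etail_def ehead_def listing_def)
    with r show ?thesis
      using that(2)[OF e(1)] that(3)[OF e(1)] that(2)[OF e(2)] that(3)[OF e(2)] by metis
  next
    case 3
    then obtain h i j where h: "h \<in> hedges H" "i < size (src H h)" "j < size (src H h)"
      and r: "r = (\<Sum>k<size (rng H h). gfwd h i k * gbwd h j k) -
        (if i = j then gvert (\<sigma> h ! i) else 0)"
      unfolding source_relations_def by blast
    show ?thesis
      by (rule that(4)[of h i True j]) (use h in \<open>simp_all add: r size_src_rng mk_edge_def\<close>,
        simp add: listing_def)
  next
    case 4
    then obtain h i j where h: "h \<in> hedges H" "i < size (rng H h)" "j < size (rng H h)"
      and r: "r = (\<Sum>k<size (src H h). gbwd h k i * gfwd h k j) -
        (if i = j then gvert (\<rho> h ! i) else 0)"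
      unfolding range_relations_def by blast
    show ?thesis
      by (rule that(4)[of h i False j]) (use h in \<open>simp_all add: r size_src_rng mk_edge_def\<close>,
        simp add: listing_def)
  qed
qed

lemma gvert_in_F: "v \<in> hverts H \<Longrightarrow> gvert v \<in> carrier F"
  unfolding gen_def by (rule free_algebra_closed) (auto simp: generators_def)

lemma gedge_in_F: "e \<in> edges H \<Longrightarrow> gedge e \<in> carrier F"
  unfolding gen_def by (rule free_algebra_closed) (auto simp: generators_def)

lemma relations_in_F: "relations \<subseteq> carrier F"
proof
  fix r :: "('v, 'e, 'k :: field) free_lpa"
  assume "r \<in> relations"
  then show "r \<in> carrier F"
    by (cases rule: relations_cases)
      (auto intro!: free_algebra_closed gvert_in_F gedge_in_F
        simp: etail_in_hverts ehead_in_hverts mk_edge_in_edges_iff listing_in_hverts)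
qed

lemma rel_ideal: "algebra_ideal rel_ideal F"
  and relations_subset_rel_ideal: "relations \<subseteq> rel_ideal"
  unfolding rel_ideal_def by (rule gen_algebra_ideal_free_algebra[OF relations_in_F])+

lemma rel_ideal_in_F: "rel_ideal \<subseteq> carrier F"
  and zero_rel_ideal: "0 \<in> rel_ideal"
  and add_rel_ideal: "x \<in> rel_ideal \<Longrightarrow> y \<in> rel_ideal \<Longrightarrow> x + y \<in> rel_ideal"
  and mult_left_rel_ideal: "a \<in> carrier F \<Longrightarrow> x \<in> rel_ideal \<Longrightarrow> a * x \<in> rel_ideal"
  and mult_right_rel_ideal: "a \<in> carrier F \<Longrightarrow> x \<in> rel_ideal \<Longrightarrow> x * a \<in> rel_ideal"
  and scale_rel_ideal: "x \<in> rel_ideal \<Longrightarrow> scale c x \<in> rel_ideal"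
proof -
  note * = rel_ideal[unfolded algebra_ideal_free_algebra_iff]
  note ** = *[THEN conjunct2, THEN conjunct2, THEN conjunct2]
  show "rel_ideal \<subseteq> carrier F"
    by (rule *[THEN conjunct1])
  show "0 \<in> rel_ideal"
    by (rule *[THEN conjunct2, THEN conjunct1])
  show "x \<in> rel_ideal \<Longrightarrow> y \<in> rel_ideal \<Longrightarrow> x + y \<in> rel_ideal"
    by (rule *[THEN conjunct2, THEN conjunct2, THEN conjunct1, rule_format])
  show "a \<in> carrier F \<Longrightarrow> x \<in> rel_ideal \<Longrightarrow> a * x \<in> rel_ideal"
    by (rule **[THEN conjunct1, rule_format, THEN conjunct1])
  show "a \<in> carrier F \<Longrightarrow> x \<in> rel_ideal \<Longrightarrow> x * a \<in> rel_ideal"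
    by (rule **[THEN conjunct1, rule_format, THEN conjunct2])
  show "x \<in> rel_ideal \<Longrightarrow> scale c x \<in> rel_ideal"
    by (rule **[THEN conjunct2, rule_format])
qed

lemma uminus_rel_ideal: "x \<in> rel_ideal \<Longrightarrow> - x \<in> rel_ideal"
  using scale_rel_ideal[of x "-1"] by (simp add: single_uminus)

lemma diff_rel_ideal: "x \<in> rel_ideal \<Longrightarrow> y \<in> rel_ideal \<Longrightarrow> x - y \<in> rel_ideal"
  using add_rel_ideal[OF _ uminus_rel_ideal] by force

lemma sum_rel_ideal: "(\<And>i. i \<in> A \<Longrightarrow> f i \<in> rel_ideal) \<Longrightarrow> sum f A \<in> rel_ideal"
  by (induction A rule: infinite_finite_induct) (auto intro: zero_rel_ideal add_rel_ideal)

lemma lin_rel_ideal: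
  "supported P f \<Longrightarrow> (\<And>w. P w \<Longrightarrow> \<phi> w \<in> rel_ideal) \<Longrightarrow> lin \<phi> f \<in> rel_ideal"
  unfolding lin_def by (intro sum_rel_ideal scale_rel_ideal) (metis supported_def)

section \<open>Congruence modulo the defining ideal\<close>

definition cong (infix "\<approx>" 50) where
  "x \<approx> y \<longleftrightarrow> x - y \<in> rel_ideal"

lemma cong_refl [simp]: "x \<approx> x"
  by (simp add: cong_def zero_rel_ideal)

lemma cong_sym: "x \<approx> y \<Longrightarrow> y \<approx> x"
  using uminus_rel_ideal unfolding cong_def by force

lemma cong_trans [trans]: "x \<approx> y \<Longrightarrow> y \<approx> z \<Longrightarrow> x \<approx> z"
  using add_rel_ideal unfolding cong_def by force

lemma cong_add: "x \<approx> y \<Longrightarrow> x' \<approx> y' \<Longrightarrow> x + x' \<approx> y + y'"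
  using add_rel_ideal[of "x - y" "x' - y'"] unfolding cong_def by (simp add: algebra_simps)

lemma cong_diff: "x \<approx> y \<Longrightarrow> x' \<approx> y' \<Longrightarrow> x - x' \<approx> y - y'"
  using diff_rel_ideal[of "x - y" "x' - y'"] unfolding cong_def by (simp add: algebra_simps)

lemma cong_mult_left: "a \<in> carrier F \<Longrightarrow> x \<approx> y \<Longrightarrow> a * x \<approx> a * y"
  using mult_left_rel_ideal[of a "x - y"] unfolding cong_def by (simp add: algebra_simps)

lemma cong_mult_right: "a \<in> carrier F \<Longrightarrow> x \<approx> y \<Longrightarrow> x * a \<approx> y * a"
  using mult_right_rel_ideal[of a "x - y"] unfolding cong_def by (simp add: algebra_simps)

lemma cong_0_iff: "x \<approx> 0 \<longleftrightarrow> x \<in> rel_ideal"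
  by (simp add: cong_def)

lemma cong_in_rel_ideal_iff: "x \<approx> y \<Longrightarrow> x \<in> rel_ideal \<longleftrightarrow> y \<in> rel_ideal"
  by (metis cong_0_iff cong_sym cong_trans)

text \<open>The class of \<open>x\<close> lies in the corner u L v.\<close>

definition local_at :: "'v \<Rightarrow> 'v \<Rightarrow> ('v, 'e, 'k :: field) free_lpa \<Rightarrow> bool" where
  "local_at u v x \<longleftrightarrow> x \<in> carrier F \<and> gvert u * x \<approx> x \<and> x * gvert v \<approx> x"

lemma local_at_gvert_mult:
  assumes "u \<in> hverts H" "v \<in> hverts H" "x \<in> carrier F"
  shows "local_at u v (gvert u * x * gvert v)"
proof -
  have idem: "gvert u' * gvert u' \<approx> (gvert u' :: ('v, 'e, 'a) free_lpa)" if "u' \<in> hverts H" for u'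
    unfolding cong_def using vertex_relation[OF that that] relations_subset_rel_ideal by auto
  note [simp] = free_algebra_closed(4)[OF free_algebra_closed(4)[OF gvert_in_F[OF assms(1)] assms(3)] gvert_in_F[OF assms(2)]]
    free_algebra_closed(4)[OF assms(3) gvert_in_F[OF assms(2)]]
    free_algebra_closed(4)[OF gvert_in_F[OF assms(1)] assms(3)]
    free_algebra_closed(4)[OF gvert_in_F[OF assms(1)] free_algebra_closed(4)[OF assms(3) gvert_in_F[OF assms(2)]]]
  have "gvert u * gvert u * (x * gvert v) \<approx> gvert u * (x * gvert v)"
    by (rule cong_mult_right[OF _ idem[OF assms(1)]]) simp
  moreover have "(gvert u * x) * (gvert v * gvert v) \<approx> (gvert u * x) * gvert v"
    by (rule cong_mult_left[OF _ idem[OF assms(2)]]) simp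
  ultimately show ?thesis
    by (simp add: local_at_def mult.assoc)
qed

lemma gedge_mult_local_at:
  assumes "local_at u v x" "e \<in> edges H" "ehead e = u"
  shows "local_at (etail e) v (gedge e * x)"
proof -
  have x: "x \<in> carrier F" "x * gvert v \<approx> x"
    using assms(1) by (simp_all add: local_at_def)
  have "gvert (etail e) * gedge e \<approx> (gedge e :: ('v, 'e, 'a) free_lpa)"
    unfolding cong_def using edge_tail_relation[OF assms(2)] relations_subset_rel_ideal by blast
  from cong_mult_right[OF x(1) this] cong_mult_left[OF gedge_in_F[OF assms(2)] x(2)]
  show ?thesis
    by (simp add: local_at_def mult.assoc free_algebra_closed(4)[OF gedge_in_F[OF assms(2)] x(1)])
qed

end

text \<open>
  The marks \<open>\<kappa>\<close> single out, for every listing, the summand of relations (iii) and (iv) that is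
  eliminated in favour of the others.
\<close>

locale marked_hypergraph = listed_hypergraph H \<sigma> \<rho>
  for H :: "('v, 'e) hypergraph" and \<sigma> \<rho> :: "'e \<Rightarrow> 'v list" +
  fixes \<kappa> :: "bool \<Rightarrow> 'e \<Rightarrow> nat"
  assumes mark_less: "h \<in> hedges H \<Longrightarrow> \<kappa> s h < length (listing s h)"
begin

section \<open>Irreducible paths and the rewriting action\<close>

fun start :: "('v, 'e) generator list \<Rightarrow> 'v" where
  "start (Vert u # w) = u"
| "start (Edge e # w) = etail e"
| "start [] = undefined"

text \<open>The summand to be eliminated: \<open>e\<close> and \<open>f\<close> are h_ik and h_jk^*,
  or h_ki^* and h_kj, where k is the marked index and i, j are arbitrary.\<close>

definition reducible :: "'e edge \<Rightarrow> 'e edge \<Rightarrow> bool" where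
  "reducible e f \<longleftrightarrow>
    hy e = hy f \<and> sg f = (\<not> sg e) \<and> ri e = li f \<and> li f = \<kappa> (sg f) (hy f)"

definition admissible :: "'e edge \<Rightarrow> ('v, 'e) generator list \<Rightarrow> bool" where
  "admissible e w \<longleftrightarrow> (\<forall>f q. w = Edge f # q \<longrightarrow> \<not> reducible e f)"

lemma admissible_simps [simp]:
  "admissible e []" "admissible e (Vert u # w)" "admissible e (Edge f # w) \<longleftrightarrow> \<not> reducible e f"
  by (auto simp: admissible_def)

definition mark_compl :: "bool \<Rightarrow> 'e \<Rightarrow> nat set" where
  "mark_compl s h = {..<length (listing s h)} - {\<kappa> s h}"

text \<open>The product of two consecutive edges at a marked index, rewritten by relation (iii) or (iv).\<close>

definition reduct :: "'e edge \<Rightarrow> 'e edge \<Rightarrow> ('v, 'e) generator list \<Rightarrow> ('v, 'e, 'k :: field) free_lpa" where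
  "reduct e f w = (if li e = ri f then mon w else 0) -
    (\<Sum>k\<in>mark_compl (sg f) (hy f).
      mon (Edge (mk_edge (sg e) (hy e) (li e) k) # Edge (mk_edge (sg f) (hy f) k (ri f)) # w))"

text \<open>A generator is put in front and at most one rewriting step follows. The default
  \<open>0\<close> of the \<open>case\<close> is never reached, since only a word that begins with
  an edge can fail to be admissible.\<close>

fun act_gen :: "('v, 'e) generator \<Rightarrow> ('v, 'e) generator list \<Rightarrow> ('v, 'e, 'k :: field) free_lpa" where
  "act_gen (Vert u) w = (if start w = u then mon w else 0)"
| "act_gen (Edge e) w =
    (if start w = ehead e
     then if admissible e w then mon (Edge e # w)
       else (case w of Edge f # q \<Rightarrow> reduct e f q | _ \<Rightarrow> 0)
     else 0)"

text \<open>The closing letter \<open>Vert v\<close> records the end of the path and makes the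
  trivial path a nonempty word, hence an element of the non-unital free algebra.\<close>

inductive normal :: "'v \<Rightarrow> ('v, 'e) generator list \<Rightarrow> bool" for v where
  Vert: "v \<in> hverts H \<Longrightarrow> normal v [Vert v]"
| Edge: "normal v w \<Longrightarrow> e \<in> edges H \<Longrightarrow> start w = ehead e \<Longrightarrow> admissible e w \<Longrightarrow> normal v (Edge e # w)"

definition act_word :: "('v, 'e) generator list \<Rightarrow> ('v, 'e, 'k :: field) free_lpa \<Rightarrow> ('v, 'e, 'k) free_lpa" where
  "act_word w = foldr (\<lambda>g. lin (act_gen g)) w"

definition act :: "('v, 'e, 'k :: field) free_lpa \<Rightarrow> ('v, 'e, 'k) free_lpa \<Rightarrow> ('v, 'e, 'k) free_lpa" where
  "act f x = lin (\<lambda>w. act_word w x) f"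

lemma act_word_simps [simp]:
  "act_word [] x = x" "act_word (g # w) x = lin (act_gen g) (act_word w x)"
  by (simp_all add: act_word_def)

lemma act_word_append: "act_word (u @ w) x = act_word u (act_word w x)"
  by (induction u) simp_all

lemma act_word_add: "act_word w (x + y) = act_word w x + act_word w y"
  by (induction w) (simp_all add: lin_add)

lemma act_word_scale: "act_word w (scale c x) = scale c (act_word w x)"
  by (induction w) (simp_all add: lin_scale)

lemma act_add_left: "act (f + g) x = act f x + act g x"
  by (simp add: act_def lin_add)

lemma act_diff_left: "act (f - g) x = act f x - act g x"
  by (simp add: act_def lin_diff)

lemma act_scale_left: "act (scale c f) x = scale c (act f x)"
  by (simp add: act_def lin_scale)

lemma act_sum_left: "act (\<Sum>i\<in>A. f i) x = (\<Sum>i\<in>A. act (f i) x)"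
  by (simp add: act_def lin_sum)

lemma act_zero_left [simp]: "act 0 x = 0"
  by (simp add: act_def)

lemma act_mon: "act (mon w) x = act_word w x"
  by (simp add: act_def)

lemma act_gen [simp]: "act (gen g) x = lin (act_gen g) x"
  by (simp add: gen_def act_mon)

lemma act_add: "act f (x + y) = act f x + act f y"
  by (simp add: act_def act_word_add lin_fun_add)

lemma act_scale: "act f (scale c x) = scale c (act f x)"
  by (simp add: act_def act_word_scale lin_fun_scale)

lemma act_zero [simp]: "act f 0 = 0"
  using act_add[of f 0 0] by simp

lemma act_sum: "act f (\<Sum>i\<in>A. x i) = (\<Sum>i\<in>A. act f (x i))"
  by (induction A rule: infinite_finite_induct) (simp_all add: act_add)

lemma act_lin: "act f (lin \<phi> x) = lin (\<lambda>w. act f (\<phi> w)) x"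
  by (simp add: lin_def act_sum act_scale)

lemma act_eq_lin: "act f x = lin (\<lambda>w. act f (mon w)) x"
  using act_lin[of f mon x] by (simp add: lin_mon)

lemma act_mult: "act (f * g) x = act f (act g x)"
proof (induction f rule: poly_linear_induct)
  case (mon u)
  show ?case
  proof (induction g rule: poly_linear_induct)
    case (mon v)
    show ?case
      by (simp only: mon_mult act_mon act_word_append)
  qed (simp_all only: distrib_left scale_mult_right act_add act_add_left act_scale act_scale_left)
qed (simp_all only: distrib_right mult.assoc act_add_left act_scale_left)

section \<open>Invariance of the span of irreducible paths\<close>

lemma normal_start: "normal v w \<Longrightarrow> start w \<in> hverts H"
  by (induction rule: normal.induct) (simp_all add: etail_in_hverts)

lemma normal_not_Nil [simp]: "\<not> normal v []"
  by (auto elim: normal.cases)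

lemma normal_EdgeD:
  assumes "normal v (Edge e # w)"
  shows "normal v w" "e \<in> edges H" "start w = ehead e" "admissible e w"
  using assms by (auto elim: normal.cases)

lemma normal_generators: "normal v w \<Longrightarrow> set w \<subseteq> generators H"
  by (induction rule: normal.induct) (auto simp: generators_def)

lemma normal_in_F: "supported (normal v) x \<Longrightarrow> x \<in> carrier F"
  unfolding carrier_free_algebra supported_def using normal_generators normal_not_Nil by metis

text \<open>Only the head index of an edge meets the next letter, so its tail index may
  vary.\<close>

lemma admissible_mk_edge: "admissible (mk_edge s h i j) w = admissible (mk_edge s h i' j) w"
  by (simp add: admissible_def reducible_def)

lemma normal_replace:
  assumes "normal v (Edge (mk_edge s h i j) # w)" "i' < length (listing s h)"
  shows "normal v (Edge (mk_edge s h i' j) # w)"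
  using normal_EdgeD[OF assms(1)] assms(2) admissible_mk_edge[of s h i j w i']
  by (intro normal.Edge) (auto simp: mk_edge_in_edges_iff)

text \<open>A single step already ends in irreducible paths: in the new words the inner index
  \<open>k\<close> is unmarked, and the junction with the rest \<open>q\<close> depends on
  \<open>ri f\<close>, which is unchanged.\<close>

lemma normal_reduct:
  assumes f: "normal v (Edge f # q)" and e: "e \<in> edges H" and red: "reducible e f"
  shows "supported (\<lambda>w. normal v w \<and> start w = etail e) (reduct e f q)"
proof -
  have sg: "sg f = (\<not> sg e)" and hy: "hy f = hy e"
    using red by (simp_all add: reducible_def)
  have "normal v q" "start q = ehead f"
    using normal_EdgeD[OF f] by auto
  \<comment> \<open>Equal outer indices mean that \<open>f\<close> is the reverse of
    \<open>e\<close>, hence ends where \<open>e\<close> starts.\<close>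
  then have q: "normal v q \<and> start q = etail e" if "li e = ri f"
    using that by (simp add: etail_def ehead_def sg hy)
  have f': "normal v (Edge (mk_edge (\<not> sg e) (hy e) (li f) (ri f)) # q)"
    using f mk_edge_eq[of f] by (simp add: sg hy)
  have k: "normal v (Edge (mk_edge (sg e) (hy e) (li e) k) # Edge (mk_edge (\<not> sg e) (hy e) k (ri f)) # q)"
    if k: "k \<in> mark_compl (\<not> sg e) (hy e)" for k
  proof (rule normal.Edge)
    show "normal v (Edge (mk_edge (\<not> sg e) (hy e) k (ri f)) # q)"
      by (rule normal_replace[OF f']) (use k in \<open>simp add: mark_compl_def\<close>)
    show "mk_edge (sg e) (hy e) (li e) k \<in> edges H"
      using e k by (simp add: mk_edge_in_edges_iff in_edges_iff[of e] mark_compl_def)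
    show "admissible (mk_edge (sg e) (hy e) (li e) k) (Edge (mk_edge (\<not> sg e) (hy e) k (ri f)) # q)"
      using k by (simp add: reducible_def mark_compl_def)
  qed simp
  show ?thesis
    unfolding reduct_def sg hy
  proof (intro supported_diff supported_sum supported_single)
    show "supported (\<lambda>w. normal v w \<and> start w = etail e) (if li e = ri f then mon q else 0)"
      using q by (auto intro: supported_single)
  qed (use k in \<open>simp add: etail_def\<close>)
qed

lemma normal_act_gen:
  assumes "normal v w" "g \<in> generators H"
  shows "supported (normal v) (act_gen g w)"
proof (cases g)
  case (Vert u)
  then show ?thesis
    using assms by (simp add: supported_single)
next
  case (Edge e)
  then have e: "e \<in> edges H"
    using assms(2) by (auto simp: generators_def)
  show ?thesis
  proof (cases "start w = ehead e \<and> \<not> admissible e w")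
    case True
    then obtain f q where "w = Edge f # q" "reducible e f"
      by (auto simp: admissible_def)
    with assms(1) e normal_reduct[of v f q e] Edge show ?thesis
      by (auto simp: supported_def)
  next
    case False
    then show ?thesis
      using assms(1) e Edge by (auto intro!: supported_single normal.Edge)
  qed
qed

lemma start_act_gen:
  assumes "normal v w" "e \<in> edges H"
  shows "supported (\<lambda>w. start w = etail e) (act_gen (Edge e) w)"
proof (cases "start w = ehead e \<and> \<not> admissible e w")
  case True
  then obtain f q where "w = Edge f # q" "reducible e f"
    by (auto simp: admissible_def)
  with assms normal_reduct[of v f q e] show ?thesis
    by (auto simp: supported_def)
next
  case False
  then show ?thesis
    using assms by (auto intro!: supported_single)
qed

lemma normal_act_word:
  assumes "supported (normal v) x" "set w \<subseteq> generators H"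
  shows "supported (normal v) (act_word w x)"
  using assms(2) by (induction w) (auto simp: assms(1) intro!: supported_lin normal_act_gen)

lemma normal_act:
  assumes "supported (normal v) x" "f \<in> carrier F"
  shows "supported (normal v) (act f x)"
  unfolding act_def
  by (rule supported_lin[OF assms(2)[unfolded carrier_free_algebra]])
    (simp add: normal_act_word assms(1))

lemma act_vert_eq:
  assumes "supported (\<lambda>w. start w = u) x"
  shows "lin (act_gen (Vert u)) x = x"
proof -
  have "lin (act_gen (Vert u)) x = lin mon x"
    by (rule lin_cong) (use assms in \<open>simp add: supported_def\<close>)
  then show ?thesis
    by (simp add: lin_mon)
qed

text \<open>The unmarked terms cancel against those of the reduct at the marked index.\<close>

lemma sum_relation_admissible:
  assumes h: "h \<in> hedges H"
    and w: "start w = listing s h ! j" "admissible (mk_edge (\<not> s) h k j) w"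
  shows "(\<Sum>k<length (listing (\<not> s) h).
      lin (act_gen (Edge (mk_edge s h i k))) (act_gen (Edge (mk_edge (\<not> s) h k j)) w)) =
    (if i = j then mon w else (0 :: ('v, 'e, 'k :: field) free_lpa))"
proof -
  let ?m = "\<kappa> (\<not> s) h"
  let ?t = "\<lambda>k. mon (Edge (mk_edge s h i k) # Edge (mk_edge (\<not> s) h k j) # w) :: ('v, 'e, 'k) free_lpa"
  have adm: "admissible (mk_edge (\<not> s) h k j) w" for k
    using w(2) admissible_mk_edge[of "\<not> s" h _ j w] by blast
  have "lin (act_gen (Edge (mk_edge s h i k))) (act_gen (Edge (mk_edge (\<not> s) h k j)) w) =
      (if k = ?m then (if i = j then mon w else 0) - (\<Sum>k\<in>mark_compl (\<not> s) h. ?t k) else ?t k)" for k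
    using w(1) adm[of k] by (auto simp: reducible_def reduct_def)
  then have "(\<Sum>k<length (listing (\<not> s) h).
      lin (act_gen (Edge (mk_edge s h i k))) (act_gen (Edge (mk_edge (\<not> s) h k j)) w)) =
    (\<Sum>k<length (listing (\<not> s) h). if k = ?m
      then (if i = j then mon w else 0) - (\<Sum>k\<in>mark_compl (\<not> s) h. ?t k) else ?t k)"
    by simp
  also have "\<dots> = ((if i = j then mon w else 0) - (\<Sum>k\<in>mark_compl (\<not> s) h. ?t k)) +
    (\<Sum>k\<in>mark_compl (\<not> s) h. ?t k)"
    unfolding mark_compl_def using mark_less[OF h, of "\<not> s"]
    by (subst sum.remove[of _ ?m]) auto
  finally show ?thesis
    by simp
qed

text \<open>The new case is the overlap of (iii) with (iv): the inner product rewrites because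
  \<open>w\<close> begins with an edge whose tail index \<open>j\<close> is marked. Rewriting yields
  words with unmarked tail indices \<open>l\<close> instead, and to these the admissible case
  applies.\<close>

lemma sum_relation_act:
  assumes h: "h \<in> hedges H" and ij: "i < length (listing s h)" "j < length (listing s h)"
    and w: "normal v w"
  shows "(\<Sum>k<length (listing (\<not> s) h).
      lin (act_gen (Edge (mk_edge s h i k))) (act_gen (Edge (mk_edge (\<not> s) h k j)) w)) =
    (if i = j \<and> start w = listing s h ! j then mon w else (0 :: ('v, 'e, 'k :: field) free_lpa))"
proof (cases "start w = listing s h ! j")
  case False
  then show ?thesis
    by simp
next
  case start: True
  show ?thesis
  \<comment> \<open>The index \<open>0\<close> is a dummy, as admissibility ignores the tail
    index.\<close>
  proof (cases "admissible (mk_edge (\<not> s) h 0 j) w")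
    case True
    then show ?thesis
      by (simp add: sum_relation_admissible[OF h start True] start del: act_gen.simps)
  next
    case False
    then obtain f q where w_eq: "w = Edge f # q" and red: "reducible (mk_edge (\<not> s) h 0 j) f"
      by (auto simp: admissible_def)
    define m where "m = ri f"
    from red have j: "j = \<kappa> s h" and f: "f = mk_edge s h j m"
      using mk_edge_eq[of f] by (auto simp: reducible_def m_def)
    have nq: "normal v q" "start q = ehead f" "admissible f q" and f_edge: "f \<in> edges H"
      using normal_EdgeD[of v f q] w w_eq by auto
    have m: "m < length (listing (\<not> s) h)"
      using f_edge f by (simp add: mk_edge_in_edges_iff)
    let ?L = "{..<length (listing (\<not> s) h)}" and ?l = "\<lambda>k. lin (act_gen (Edge (mk_edge s h i k)))"
    let ?w = "\<lambda>l. Edge (mk_edge s h l m) # q" and ?C = "mark_compl s h"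
    have red_k: "\<not> admissible (mk_edge (\<not> s) h k j) w" for k
      using red w_eq by (simp add: reducible_def)
    \<comment> \<open>The subtracted words are written as results of the action, so that after
      exchanging the sums the one over \<open>k\<close> is an instance of the admissible
      case.\<close>
    have inner: "act_gen (Edge (mk_edge (\<not> s) h k j)) w = ((if k = m then mon q else 0) -
        (\<Sum>l\<in>?C. act_gen (Edge (mk_edge (\<not> s) h k l)) (?w l)) :: ('v, 'e, 'k) free_lpa)" for k
    proof -
      have "(\<Sum>l\<in>?C. act_gen (Edge (mk_edge (\<not> s) h k l)) (?w l) :: ('v, 'e, 'k) free_lpa) =
          (\<Sum>l\<in>?C. mon (Edge (mk_edge (\<not> s) h k l) # ?w l))"
        by (rule sum.cong) (auto simp: reducible_def mark_compl_def)
      then show ?thesis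
        using red_k[of k] start w_eq f by (simp only:) (simp add: reduct_def)
    qed
    have adm_q: "admissible (mk_edge s h i m) q"
      using nq(3) admissible_mk_edge[of s h j m q i] f by simp
    have "?l k (act_gen (Edge (mk_edge (\<not> s) h k j)) w) =
        (if k = m then ?l m (mon q) else 0) -
        ((\<Sum>l\<in>?C. ?l k (act_gen (Edge (mk_edge (\<not> s) h k l)) (?w l))) :: ('v, 'e, 'k) free_lpa)" for k
      unfolding inner lin_diff lin_sum by (cases "k = m") (simp_all only: if_True if_False lin_0 simp_thms)
    then have "(\<Sum>k\<in>?L. ?l k (act_gen (Edge (mk_edge (\<not> s) h k j)) w)) =
      (\<Sum>k\<in>?L. if k = m then ?l m (mon q) else 0) -
      ((\<Sum>k\<in>?L. \<Sum>l\<in>?C. ?l k (act_gen (Edge (mk_edge (\<not> s) h k l)) (?w l))) :: ('v, 'e, 'k) free_lpa)"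
      by (simp only: sum_subtractf)
    also have "(\<Sum>k\<in>?L. if k = m then ?l m (mon q) else 0) = (mon (?w i) :: ('v, 'e, 'k) free_lpa)"
      using m adm_q nq(2) f by simp
    also have "(\<Sum>k\<in>?L. \<Sum>l\<in>?C. ?l k (act_gen (Edge (mk_edge (\<not> s) h k l)) (?w l))) =
        ((\<Sum>l\<in>?C. \<Sum>k\<in>?L. ?l k (act_gen (Edge (mk_edge (\<not> s) h k l)) (?w l))) :: ('v, 'e, 'k) free_lpa)"
      by (rule sum.swap)
    also have "\<dots> = (\<Sum>l\<in>?C. if i = l then mon (?w i) else 0)"
    proof (rule sum.cong)
      fix l assume "l \<in> ?C"
      then have adm: "admissible (mk_edge (\<not> s) h 0 l) (?w l)"
        by (auto simp: reducible_def mark_compl_def)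
      have st: "start (?w l) = listing s h ! l"
        by simp
      have "(\<Sum>k\<in>?L. ?l k (act_gen (Edge (mk_edge (\<not> s) h k l)) (?w l))) =
          (if i = l then mon (?w l) else (0 :: ('v, 'e, 'k) free_lpa))"
        by (rule sum_relation_admissible[OF h st adm])
      then show "(\<Sum>k\<in>?L. ?l k (act_gen (Edge (mk_edge (\<not> s) h k l)) (?w l))) =
          (if i = l then mon (?w i) else (0 :: ('v, 'e, 'k) free_lpa))"
        by (cases "i = l") (simp_all only: if_True if_False simp_thms)
    qed simp
    \<comment> \<open>Only \<open>l = i\<close> survives, and it is missing from the sum exactly if
      \<open>i\<close> is the mark \<open>j\<close>.\<close>
    also have "\<dots> = (if i = j then 0 else mon (?w i))"
      using ij j by (simp add: mark_compl_def)
    also have "mon (?w i) - (if i = j then 0 else mon (?w i)) =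
        (if i = j \<and> start w = listing s h ! j then mon w else (0 :: ('v, 'e, 'k) free_lpa))"
      using start w_eq f by simp
    finally show ?thesis .
  qed
qed

lemma act_relation:
  assumes "r \<in> relations" "normal v w"
  shows "act r (mon w) = 0"
  using assms(1)
proof (cases rule: relations_cases)
  case (vertex u u')
  then show ?thesis
    by (simp add: act_diff_left act_mult)
next
  case (tail e)
  then show ?thesis
    using act_vert_eq[OF start_act_gen[OF assms(2) tail(1)]]
    by (simp add: act_diff_left act_mult)
next
  case (head e)
  then show ?thesis
    by (simp add: act_diff_left act_mult)
next
  case (sum s h i j)
  then show ?thesis
    by (simp add: act_diff_left act_mult act_sum_left sum_relation_act[OF sum(1,2,3) assms(2)]
        del: act_gen.simps(2))
qed

text \<open>The elements of \<open>F\<close> that annihilate all irreducible paths ending at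
  \<open>v\<close> form an ideal, because these paths span an invariant subspace; this ideal
  contains the relations.\<close>

lemma act_rel_ideal:
  fixes f :: "('v, 'e, 'k :: field) free_lpa"
  assumes "f \<in> rel_ideal" "supported (normal v) x"
  shows "act f x = 0"
proof -
  let ?J = "{f \<in> carrier F. \<forall>x :: ('v, 'e, 'k) free_lpa. supported (normal v) x \<longrightarrow> act f x = 0}"
  have "algebra_ideal ?J F"
    unfolding algebra_ideal_free_algebra_iff
    by (auto simp: free_algebra_closed act_add_left act_mult act_scale_left normal_act)
  moreover have "relations \<subseteq> ?J"
  proof
    fix r :: "('v, 'e, 'k) free_lpa"
    assume r: "r \<in> relations"
    have "act r x = 0" if "supported (normal v) x" for x
    proof -
      have "act r x = lin (\<lambda>w. 0) x"
        unfolding act_eq_lin[of r x]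
        by (rule lin_cong) (use that act_relation[OF r, of v "letters w" for w] in \<open>simp add: supported_def\<close>)
      then show ?thesis
        by (simp add: lin_def)
    qed
    then show "r \<in> ?J"
      using r relations_in_F by blast
  qed
  ultimately have "rel_ideal \<subseteq> ?J"
    unfolding rel_ideal_def by (rule gen_algebra_ideal_least)
  then show ?thesis
    using assms by blast
qed


section \<open>Normal forms\<close>

lemma gen_mult_mon: "gen g * mon w = mon (g # w)"
  by (simp add: gen_def mon_mult)

lemma mon_in_F: "w \<noteq> [] \<Longrightarrow> set w \<subseteq> generators H \<Longrightarrow> mon w \<in> carrier F"
  by (rule free_algebra_closed)

lemma normal_mon_in_F: "normal v w \<Longrightarrow> mon w \<in> carrier F"
  by (intro normal_in_F[of v] supported_single) simp

lemma gvert_mult_gvert: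
  "u \<in> hverts H \<Longrightarrow> v \<in> hverts H \<Longrightarrow> gvert u * gvert v \<approx> (if u = v then gvert u else 0)"
  using vertex_relation relations_subset_rel_ideal unfolding cong_def by blast

lemma gvert_mult_gedge: "e \<in> edges H \<Longrightarrow> gvert (etail e) * gedge e \<approx> gedge e"
  using edge_tail_relation relations_subset_rel_ideal unfolding cong_def by blast

lemma gedge_mult_gvert: "e \<in> edges H \<Longrightarrow> gedge e * gvert (ehead e) \<approx> gedge e"
  using edge_head_relation relations_subset_rel_ideal unfolding cong_def by blast

lemma start_generator: "g \<in> generators H \<Longrightarrow> start [g] \<in> hverts H"
  by (auto simp: generators_def etail_in_hverts)

lemma gvert_mult_gen:
  assumes "g \<in> generators H"
  shows "gvert (start [g]) * gen g \<approx> gen g"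
proof (cases g)
  case (Vert u)
  then show ?thesis
    using assms by (simp, intro cong_trans[OF gvert_mult_gvert]) (auto simp: generators_def)
next
  case (Edge e)
  then show ?thesis
    using assms by (auto simp: generators_def intro: gvert_mult_gedge)
qed

fun finish :: "('v, 'e) generator \<Rightarrow> 'v" where
  "finish (Vert u) = u"
| "finish (Edge e) = ehead e"

lemma finish_generator: "g \<in> generators H \<Longrightarrow> finish g \<in> hverts H"
  by (auto simp: generators_def ehead_in_hverts)

lemma gen_mult_gvert:
  assumes "g \<in> generators H"
  shows "gen g * gvert (finish g) \<approx> gen g"
proof (cases g)
  case (Vert u)
  then show ?thesis
    using assms by (simp, intro cong_trans[OF gvert_mult_gvert]) (auto simp: generators_def)
next
  case (Edge e)
  then show ?thesis
    using assms by (auto simp: generators_def intro: gedge_mult_gvert)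
qed

lemma gvert_mult_mon:
  assumes u: "u \<in> hverts H" and w: "w \<noteq> []" "set w \<subseteq> generators H"
  shows "gvert u * mon w \<approx> (if u = start w then mon w else (0 :: ('v, 'e, 'k :: field) free_lpa))"
proof -
  obtain g q where w_eq: "w = g # q"
    using w(1) by (cases w) auto
  have start: "start [g] = start w"
    by (cases g) (simp_all add: w_eq)
  have g_gen: "g \<in> generators H"
    using w(2) w_eq by simp
  have g: "start w \<in> hverts H" "gvert (start w) * gen g \<approx> (gen g :: ('v, 'e, 'k) free_lpa)"
    using start_generator[OF g_gen] gvert_mult_gen[OF g_gen] by (simp_all only: start)
  have gF: "(gen g :: ('v, 'e, 'k) free_lpa) \<in> carrier F"
    unfolding gen_def by (rule mon_in_F) (use w(2) w_eq in auto)
  have "gvert u * gen g \<approx> gvert u * (gvert (start w) * gen g :: ('v, 'e, 'k) free_lpa)"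
    by (rule cong_mult_left[OF gvert_in_F[OF u] cong_sym[OF g(2)]])
  also have "\<dots> = (gvert u * gvert (start w)) * gen g"
    by (simp add: mult.assoc)
  also have "\<dots> \<approx> (if u = start w then gvert u else 0) * gen g"
    by (rule cong_mult_right[OF gF gvert_mult_gvert[OF u g(1)]])
  also have "\<dots> \<approx> (if u = start w then gen g else 0)"
    using g(2) by simp
  finally have *: "gvert u * gen g \<approx> (if u = start w then gen g else (0 :: ('v, 'e, 'k) free_lpa))" .
  show ?thesis
  \<comment> \<open>One-letter words are separate because \<open>mon []\<close> lies outside
    \<open>F\<close>, while congruences may be multiplied by elements of \<open>F\<close>
    only.\<close>
  proof (cases "q = []")
    case True
    then show ?thesis
      using * by (simp add: w_eq gen_def cong: if_cong)
  next
    case False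
    then have "(mon q :: ('v, 'e, 'k) free_lpa) \<in> carrier F"
      using w(2) w_eq by (intro mon_in_F) auto
    from cong_mult_right[OF this *] show ?thesis
      by (simp add: w_eq mult.assoc gen_mult_mon if_distrib[of "\<lambda>x. x * _"] cong: if_cong)
  qed
qed

lemma mon_mult_gvert:
  assumes u: "u \<in> hverts H" and w: "w \<noteq> []" "set w \<subseteq> generators H"
  shows "mon w * gvert u \<approx> (if u = finish (last w) then mon w else (0 :: ('v, 'e, 'k :: field) free_lpa))"
proof -
  define g q where "g = last w" and "q = butlast w"
  have w_eq: "w = q @ [g]"
    using w(1) by (simp add: g_def q_def)
  have g_gen: "g \<in> generators H"
    using w(2) w_eq by simp
  have g: "finish g \<in> hverts H" "gen g * gvert (finish g) \<approx> (gen g :: ('v, 'e, 'k) free_lpa)"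
    by (rule finish_generator[OF g_gen], rule gen_mult_gvert[OF g_gen])
  have gF: "(gen g :: ('v, 'e, 'k) free_lpa) \<in> carrier F"
    unfolding gen_def by (rule mon_in_F) (use w(2) w_eq in auto)
  have "gen g * gvert u \<approx> (gen g * gvert (finish g)) * (gvert u :: ('v, 'e, 'k) free_lpa)"
    by (rule cong_mult_right[OF gvert_in_F[OF u] cong_sym[OF g(2)]])
  also have "\<dots> = gen g * (gvert (finish g) * gvert u)"
    by (simp add: mult.assoc)
  also have "\<dots> \<approx> gen g * (if finish g = u then gvert (finish g) else 0)"
    by (rule cong_mult_left[OF gF gvert_mult_gvert[OF g(1) u]])
  also have "\<dots> \<approx> (if u = finish g then gen g else 0)"
    using g(2) by auto
  finally have *: "gen g * gvert u \<approx> (if u = finish g then gen g else (0 :: ('v, 'e, 'k) free_lpa))" .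
  have mon: "mon w = (mon q * gen g :: ('v, 'e, 'k) free_lpa)"
    by (simp add: w_eq gen_def mon_mult)
  show ?thesis
  proof (cases "q = []")
    case True
    then show ?thesis
      using * by (simp add: w_eq gen_def cong: if_cong)
  next
    case False
    then have "(mon q :: ('v, 'e, 'k) free_lpa) \<in> carrier F"
      using w(2) w_eq by (intro mon_in_F) auto
    from cong_mult_left[OF this *] show ?thesis
      unfolding mon g_def[symmetric]
      by (simp add: mult.assoc if_distrib[of "\<lambda>x. _ * x"] cong: if_cong)
  qed
qed

lemma normal_neq_Nil: "normal v w \<Longrightarrow> w \<noteq> []"
  by auto

lemma not_admissibleE:
  assumes "\<not> admissible e w"
  obtains f q where "w = Edge f # q" "reducible e f"
  using assms by (auto simp: admissible_def)

text \<open>A rewriting step is relation (iii) or (iv) solved for its marked summand, so modulo the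
  ideal the action is left multiplication.\<close>

lemma act_gen_cong:
  assumes w: "normal v w" and g: "g \<in> generators H"
  shows "act_gen g w \<approx> (gen g * mon w :: ('v, 'e, 'k :: field) free_lpa)"
proof (cases g)
  case (Vert u)
  then have "u \<in> hverts H"
    using g by (auto simp: generators_def)
  then have "gvert u * mon w \<approx> (if u = start w then mon w else (0 :: ('v, 'e, 'k) free_lpa))"
    by (rule gvert_mult_mon[OF _ normal_neq_Nil[OF w] normal_generators[OF w]])
  then have "gvert u * mon w \<approx> (act_gen g w :: ('v, 'e, 'k) free_lpa)"
    by (simp add: Vert eq_commute[of "start w"])
  then show ?thesis
    unfolding Vert by (rule cong_sym)
next
  case (Edge e)
  then have e: "e \<in> edges H"
    using g by (auto simp: generators_def)
  consider "start w \<noteq> ehead e" | "start w = ehead e" "admissible e w" |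
    f q where "start w = ehead e" "w = Edge f # q" "reducible e f"
    by (cases "start w = ehead e"; cases "admissible e w") (auto elim: not_admissibleE)
  then show ?thesis
  proof cases
    case 1
    have "gedge e * mon w \<approx> (gedge e * gvert (ehead e)) * (mon w :: ('v, 'e, 'k) free_lpa)"
      by (rule cong_mult_right[OF normal_mon_in_F[OF w] cong_sym[OF gedge_mult_gvert[OF e]]])
    also have "\<dots> = gedge e * (gvert (ehead e) * mon w)"
      by (simp add: mult.assoc)
    also have "\<dots> \<approx> gedge e * (if ehead e = start w then mon w else 0)"
      by (rule cong_mult_left[OF gedge_in_F[OF e]
            gvert_mult_mon[OF ehead_in_hverts[OF e] normal_neq_Nil[OF w] normal_generators[OF w]]])
    finally have "gedge e * mon w \<approx> (act_gen g w :: ('v, 'e, 'k) free_lpa)"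
      using 1 by (simp add: Edge)
    then show ?thesis
      unfolding Edge by (rule cong_sym)
  next
    case 2
    then show ?thesis
      using Edge by (simp add: gen_mult_mon)
  next
    case (3 f q)
    note red = 3(3)
    define s h i j k where "s = sg e" and "h = hy e" and "i = li e" and "j = ri f" and "k = ri e"
    have e_eq: "e = mk_edge s h i k"
      by (simp add: s_def h_def i_def k_def)
    have f_eq: "f = mk_edge (\<not> s) h k j" and k: "k = \<kappa> (\<not> s) h"
      using red mk_edge_eq[of f]
      by (simp_all add: s_def h_def k_def j_def reducible_def del: mk_edge_eq)
    have q: "normal v q" "start q = ehead f" "f \<in> edges H"
      using normal_EdgeD[of v f q] w 3(2) by simp_all
    have h: "h \<in> hedges H" "i < length (listing s h)" "j < length (listing s h)"
      "k < length (listing (\<not> s) h)"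
      using e q(3) by (simp_all add: e_eq f_eq mk_edge_in_edges_iff)
    let ?t = "\<lambda>k. gedge (mk_edge s h i k) * gedge (mk_edge (\<not> s) h k j) :: ('v, 'e, 'k) free_lpa"
    have "(\<Sum>k<length (listing (\<not> s) h). ?t k :: ('v, 'e, 'k) free_lpa) - (if i = j then gvert (listing s h ! i) else 0) \<in> rel_ideal"
      by (rule subsetD[OF relations_subset_rel_ideal sum_relation[OF h(1,2,3)]])
    then have "(\<Sum>k<length (listing (\<not> s) h). ?t k) * mon q -
        (if i = j then gvert (listing s h ! i) else 0) * mon q \<in> rel_ideal"
      unfolding left_diff_distrib[symmetric]
      by (rule mult_right_rel_ideal[OF normal_mon_in_F[OF q(1)]])
    moreover have "(\<Sum>k<length (listing (\<not> s) h). ?t k) =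
        ?t k + (\<Sum>k\<in>mark_compl (\<not> s) h. ?t k)"
      using h(4) unfolding mark_compl_def k[symmetric] by (intro sum.remove) auto
    ultimately have *: "?t k * mon q \<approx> (if i = j then gvert (listing s h ! i) else 0) * mon q -
        (\<Sum>k\<in>mark_compl (\<not> s) h. ?t k * mon q)"
      by (simp add: cong_def algebra_simps sum_distrib_right)
    define S where "S = (\<Sum>k\<in>mark_compl (\<not> s) h. ?t k * mon q)"
    have "gedge e * mon w = ?t k * mon q"
      by (simp add: 3(2) e_eq f_eq gen_def mon_mult)
    then have "gedge e * mon w \<approx> (if i = j then gvert (listing s h ! i) else 0) * mon q - S"
      using * by (simp only: S_def)
    moreover have "(if i = j then gvert (listing s h ! i) else 0) * mon q - S \<approx>
        (if i = j then mon q else 0) - S"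
    proof (rule cong_diff)
      show "(if i = j then gvert (listing s h ! i) else 0) * mon q \<approx>
          (if i = j then mon q else (0 :: ('v, 'e, 'k) free_lpa))"
      proof (cases "i = j")
        case True
        from gvert_mult_mon[OF listing_in_hverts[OF h(1,2)] normal_neq_Nil[OF q(1)]
            normal_generators[OF q(1)]] True
        show ?thesis
          using q(2) by (simp add: f_eq)
      qed simp
    qed simp
    moreover have "(if i = j then mon q else 0) - S = act_gen g w"
      unfolding S_def using 3 Edge by (simp add: reduct_def e_eq f_eq gen_def mon_mult)
    ultimately have "gedge e * mon w \<approx> (act_gen g w :: ('v, 'e, 'k) free_lpa)"
      by (metis cong_trans)
    then show ?thesis
      unfolding Edge by (rule cong_sym)
  qed
qed

lemma lin_cong_ideal:
  assumes "supported P x" "\<And>w. P w \<Longrightarrow> \<phi> w \<approx> \<psi> w"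
  shows "lin \<phi> x \<approx> lin \<psi> x"
  using lin_rel_ideal[OF assms(1), of "\<lambda>w. \<phi> w - \<psi> w"] assms(2)
  by (simp add: cong_def lin_fun_diff)

lemma act_word_cong:
  assumes x: "supported (normal v) x" and "set w \<subseteq> generators H"
  shows "act_word w x \<approx> mon w * x"
  using assms(2)
proof (induction w)
  case Nil
  then show ?case
    by (simp flip: zero_word_def)
next
  case (Cons g w)
  then have g: "g \<in> generators H" and w: "set w \<subseteq> generators H"
    by auto
  have "act_word (g # w) x \<approx> lin (\<lambda>w. gen g * mon w) (act_word w x)"
    unfolding act_word_simps
    by (rule lin_cong_ideal[OF normal_act_word[OF x w] act_gen_cong[OF _ g]])
  also have "\<dots> = gen g * act_word w x"
    by (simp add: lin_mult_left[symmetric] lin_mon)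
  also have "\<dots> \<approx> gen g * (mon w * x)"
    using g by (intro cong_mult_left Cons.IH w) (simp add: gen_def mon_in_F)
  also have "\<dots> = mon (g # w) * x"
    by (simp add: gen_mult_mon flip: mult.assoc)
  finally show ?case .
qed

lemma act_cong:
  assumes "supported (normal v) x" "f \<in> carrier F"
  shows "act f x \<approx> f * x"
proof -
  have "act f x \<approx> lin (\<lambda>w. mon w * x) f"
    unfolding act_def
    by (rule lin_cong_ideal[OF assms(2)[unfolded carrier_free_algebra]])
      (simp add: act_word_cong[OF assms(1)])
  then show ?thesis
    by (simp add: lin_mon_mult)
qed

text \<open>Deletes the closing vertex letter; the trivial path becomes the unit of the ambient
  algebra.\<close>

definition strip :: "('v, 'e, 'k :: field) free_lpa \<Rightarrow> ('v, 'e, 'k) free_lpa" where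
  "strip = lin (\<lambda>w. mon (butlast w))"

lemma normal_last: "normal v w \<Longrightarrow> w = butlast w @ [Vert v]"
  by (induction rule: normal.induct) (auto split: if_splits)

lemma strip_mult_gvert:
  assumes "supported (normal v) d"
  shows "strip d * gvert v = d"
proof -
  have "strip d * gvert v = lin mon d"
    unfolding strip_def lin_mult_right
  proof (rule lin_cong)
    fix w assume "w \<in> Poly_Mapping.keys d"
    then have "letters w = butlast (letters w) @ [Vert v]"
      using assms normal_last unfolding supported_def by blast
    then show "mon (butlast (letters w)) * gvert v = mon (letters w)"
      by (metis gen_def mon_mult)
  qed
  then show ?thesis
    by (simp add: lin_mon)
qed

section \<open>Products that are plain concatenations\<close>

definition left_free :: "('v, 'e) generator list \<Rightarrow> bool" where
  "left_free w \<longleftrightarrow> (\<forall>e. admissible e w)"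

lemma left_free_Edge: "li f \<noteq> \<kappa> (sg f) (hy f) \<Longrightarrow> left_free (Edge f # w)"
  by (simp add: left_free_def reducible_def)

text \<open>The closing letter of \<open>w\<close> fixes \<open>r\<close>, and the edges before it
  are prepended one by one. Start and admissibility are carried through the induction because they
  decide whether the next edge is prepended unchanged.\<close>

lemma act_word_left_free:
  assumes "normal v w" "start r = v" "left_free r"
  shows "act_word w (mon r) = mon (butlast w @ r) \<and> start (butlast w @ r) = start w \<and>
    (\<forall>e. admissible e w \<longrightarrow> admissible e (butlast w @ r))"
  using assms(1)
proof (induction rule: normal.induct)
  case Vert
  then show ?case
    using assms(2,3) by (simp add: left_free_def)
next
  case (Edge w e)
  from Edge(1) have "w \<noteq> []"
    by (rule normal_neq_Nil)
  then show ?case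
    using Edge by simp
qed

lemma act_left_free:
  fixes d Y :: "('v, 'e, 'k :: field) free_lpa"
  assumes d: "supported (normal v) d" and Y: "supported (\<lambda>r. start r = v \<and> left_free r) Y"
  shows "act d Y = strip d * Y"
proof -
  have "act_word w Y = mon (butlast w) * Y" if w: "normal v w" for w
  proof -
    have "act_word w Y = act (mon w) Y"
      by (simp add: act_mon)
    also have "\<dots> = lin (\<lambda>r. act (mon w) (mon r)) Y"
      by (rule act_eq_lin)
    also have "\<dots> = lin (\<lambda>r. mon (butlast w) * mon r) Y"
    proof (rule lin_cong)
      fix r assume "r \<in> Poly_Mapping.keys Y"
      then have "start (letters r) = v" "left_free (letters r)"
        using Y by (auto simp: supported_def)
      then show "act (mon w) (mon (letters r)) = mon (butlast w) * mon (letters r)"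
        by (simp only: act_mon mon_mult act_word_left_free[OF w])
    qed
    also have "\<dots> = mon (butlast w) * Y"
      by (simp only: lin_mult_left[symmetric] lin_mon)
    finally show ?thesis .
  qed
  then have "act d Y = lin (\<lambda>w. mon (butlast w) * Y) d"
    unfolding act_def using d by (intro lin_cong) (simp add: supported_def)
  then show ?thesis
    by (simp only: strip_def lin_mult_right)
qed

text \<open>An edge with unmarked head index is never the left factor of a reducible pair.\<close>

lemma act_gedge_right_free:
  assumes "ri e \<noteq> \<kappa> (\<not> sg e) (hy e)" "supported (\<lambda>w. start w = ehead e) Y"
  shows "act (gedge e) Y = gedge e * Y"
proof -
  have adm: "admissible e w" for w
    unfolding admissible_def
  proof (intro allI impI notI)
    fix f q
    assume "reducible e f"
    then have "sg f = (\<not> sg e)" "hy f = hy e" "ri e = \<kappa> (sg f) (hy f)"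
      by (simp_all add: reducible_def)
    then show False
      using assms(1) by simp
  qed
  have "act (gedge e) Y = lin (\<lambda>w. gedge e * mon w) Y"
    unfolding act_gen
    by (rule lin_cong) (use assms(2) adm in \<open>simp add: supported_def gen_def mon_mult del: word.collapse\<close>)
  then show ?thesis
    by (simp only: lin_mult_left[symmetric] lin_mon)
qed

text \<open>The action on irreducible paths factors through the quotient. For \<open>Y\<close> a
  vertex this is the uniqueness of normal forms.\<close>

lemma act_cong_left:
  assumes "x \<approx> y" "supported (normal v) Y"
  shows "act x Y = act y Y"
  using act_rel_ideal[OF assms(1)[unfolded cong_def] assms(2)] by (simp add: act_diff_left)

lemma supported_start_act_gvert: "supported (\<lambda>w. start w = u) (act (gvert u) Y)"
  unfolding act_gen
  by (rule supported_lin[where P = "\<lambda>_. True"]) (auto simp: supported_def)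

lemma start_act_local:
  assumes "local_at u v x" "supported (normal v') Y"
  shows "supported (\<lambda>w. start w = u) (act x Y)"
proof -
  have "act x Y = act (gvert u) (act x Y)"
    using act_cong_left[OF _ assms(2), of "gvert u * x" x] assms(1)
    by (simp add: local_at_def act_mult)
  then show ?thesis
    using supported_start_act_gvert by metis
qed

lemma supported_normal_gvert: "v \<in> hverts H \<Longrightarrow> supported (normal v) (gvert v)"
  by (simp add: gen_def supported_single normal.Vert)

lemma normal_form:
  fixes x :: "('v, 'e, 'k :: field) free_lpa"
  assumes "v \<in> hverts H" "x \<in> carrier F"
  shows "act x (gvert v) \<approx> x * gvert v" "supported (normal v) (act x (gvert v))"
  using act_cong normal_act supported_normal_gvert assms by blast+

lemma normal_form_local:
  fixes x :: "('v, 'e, 'k :: field) free_lpa"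
  assumes "v \<in> hverts H" "local_at u v x"
  shows "act x (gvert v) \<approx> x"
proof -
  have "x \<in> carrier F" "x * gvert v \<approx> x"
    using assms(2) by (simp_all add: local_at_def)
  with normal_form(1)[OF assms(1)] show ?thesis
    by (blast intro: cong_trans)
qed

lemma act_gvert_neq_0:
  fixes x :: "('v, 'e, 'k :: field) free_lpa"
  assumes "v \<in> hverts H" "local_at u v x" "x \<notin> rel_ideal"
  shows "act x (gvert v) \<noteq> 0"
proof
  assume "act x (gvert v) = 0"
  then have "0 \<approx> x"
    using normal_form_local[OF assms(1,2)] by simp
  then show False
    using cong_in_rel_ideal_iff zero_rel_ideal assms(3) by blast
qed

section \<open>Nonvanishing products and quasi-regularity\<close>

lemma gen_neq_0: "gen g \<noteq> (0 :: 'x word \<Rightarrow>\<^sub>0 'k :: field)"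
  by (metis gen_def keys_single keys_zero insert_not_empty one_neq_zero)

text \<open>On normal forms the factor \<open>gedge e\<close> multiplies as in the free algebra,
  which has no zero divisors.\<close>

lemma gedge_mult_notin_rel_ideal_right_free:
  fixes x :: "('v, 'e, 'k :: field) free_lpa"
  assumes v: "v \<in> hverts H" and x: "local_at u v x" "x \<notin> rel_ideal"
    and e: "ehead e = u" "ri e \<noteq> \<kappa> (\<not> sg e) (hy e)"
  shows "gedge e * x \<notin> rel_ideal"
proof
  assume "gedge e * x \<in> rel_ideal"
  then have "act (gedge e * x) (gvert v) = 0"
    by (rule act_rel_ideal[OF _ supported_normal_gvert[OF v]])
  moreover have "act (gedge e * x) (gvert v) = gedge e * act x (gvert v)"
    unfolding act_mult using start_act_local[OF x(1) supported_normal_gvert[OF v]] e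
    by (intro act_gedge_right_free) simp_all
  ultimately show False
    using free_algebra_no_zero_divisors[OF gen_neq_0 act_gvert_neq_0[OF v x]] by metis
qed

lemma not_quasi_regular:
  fixes x z :: "('v, 'e, 'k :: field) free_lpa"
  assumes v: "v \<in> hverts H" and x: "local_at v v x" "x \<notin> rel_ideal"
    and e: "e \<in> edges H" "ehead e = v" "li e \<noteq> \<kappa> (sg e) (hy e)" "ri e \<noteq> \<kappa> (\<not> sg e) (hy e)"
    and z: "z \<in> carrier F"
  defines "y \<equiv> gedge e * x * gedge (mk_edge (\<not> sg e) (hy e) (ri e) (li e))"
  shows "y + z - z * y \<notin> rel_ideal"
proof
  assume qr: "y + z - z * y \<in> rel_ideal"
  define e' where "e' = mk_edge (\<not> sg e) (hy e) (ri e) (li e)"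
  define v0 where "v0 = etail e"
  define d where "d = act x (gvert v)"
  \<comment> \<open>In the free unital algebra \<open>A\<close> takes the place of \<open>y\<close>,
    and \<open>strip t\<close> that of \<open>z\<close>.\<close>
  define A where "A = gedge e * strip d * gedge e'"
  define t where "t = act z (gvert v0)"
  define U where "U = 1 - strip t"
  have e': "e' \<in> edges H" "etail e' = v" "ehead e' = v0"
    using e(1,2) by (simp_all add: e'_def mk_edge_in_edges_iff in_edges_iff[of e] v0_def
        ehead_def etail_def)
  have v0: "v0 \<in> hverts H"
    using etail_in_hverts[OF e(1)] by (simp add: v0_def)
  have xF: "x \<in> carrier F"
    using x(1) by (simp add: local_at_def)
  note \<delta> = supported_normal_gvert[OF v0]
  have d: "supported (normal v) d" "d \<approx> x" "d \<noteq> 0"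
    unfolding d_def
    by (rule normal_form(2)[OF v xF], rule normal_form_local[OF v x(1)], rule act_gvert_neq_0[OF v x])
  have strip_d: "strip d \<noteq> 0"
    using strip_mult_gvert[OF d(1)] d(3) by auto
  let ?r = "[Edge e', Vert v0]"
  have r: "normal v0 ?r" "start ?r = v" "left_free ?r"
    using e' v0 e(4) left_free_Edge[of e'] by (auto intro!: normal.intros simp: e'_def)
  have act_e': "act (gedge e') (gvert v0) = gedge e' * gvert v0"
    using e' by (simp add: gen_def act_mon mon_mult)
  have e'_mon: "gedge e' * gvert v0 = (mon ?r :: ('v, 'e, 'k) free_lpa)"
    by (simp add: gen_def mon_mult)
  have nr: "supported (normal v0) (mon ?r :: ('v, 'e, 'k) free_lpa)"
    using r(1) by (simp add: supported_single)
  have act_x: "act x (mon ?r) = strip d * mon ?r"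
  proof -
    have "act x (mon ?r) = act d (mon ?r)"
      by (rule act_cong_left[OF cong_sym[OF d(2)] nr])
    also have "\<dots> = strip d * mon ?r"
      by (rule act_left_free[OF d(1)]) (use r in \<open>simp add: supported_single\<close>)
    finally show ?thesis .
  qed
  have "act y (gvert v0) = act (gedge e) (act x (act (gedge e') (gvert v0)))"
    by (simp only: y_def e'_def act_mult)
  also have "\<dots> = gedge e * act x (mon ?r)"
    unfolding act_e' e'_mon
    by (rule act_gedge_right_free[OF e(4)]) (use start_act_local[OF x(1) nr] e(2) in simp)
  finally have act_y: "act y (gvert v0) = A * gvert v0"
    by (simp only: act_x A_def e'_mon mult.assoc)
  have Y: "supported (\<lambda>w. start w = v0 \<and> left_free w) (A * gvert v0)"
    unfolding A_def mult.assoc gen_def[of "Edge e"]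
    by (rule supported_mult[where P = "\<lambda>w. w = [Edge e]" and Q = "\<lambda>_. True"])
      (auto simp: supported_def v0_def left_free_Edge e(3))
  have yF: "y \<in> carrier F"
    unfolding y_def using gedge_in_F e(1) e'(1) xF by (intro free_algebra_closed) (auto simp: e'_def)
  have nY: "supported (normal v0) (A * gvert v0)"
    unfolding act_y[symmetric] by (rule normal_act[OF \<delta> yF])
  have t: "supported (normal v0) t" "t \<approx> z * gvert v0"
    unfolding t_def by (rule normal_form(2)[OF v0 z], rule normal_form(1)[OF v0 z])
  \<comment> \<open>No locality of \<open>z\<close> is assumed. Inserting \<open>gvert v0\<close>
    allows \<open>z\<close> to be replaced by \<open>t\<close>, the normal form of
    \<open>z * gvert v0\<close>.\<close>
  have "act z (A * gvert v0) = act z (act (gvert v0) (A * gvert v0))"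
    using act_vert_eq[of v0 "A * gvert v0"] Y by (simp add: supported_def)
  also have "\<dots> = act t (A * gvert v0)"
    unfolding act_mult[symmetric] by (rule act_cong_left[OF cong_sym[OF t(2)] nY])
  also have "\<dots> = strip t * (A * gvert v0)"
    by (rule act_left_free[OF t(1) Y])
  finally have act_z: "act z (A * gvert v0) = strip t * (A * gvert v0)" .
  have "act (y + z - z * y) (gvert v0) = 0"
    by (rule act_rel_ideal[OF qr \<delta>])
  then have "A * gvert v0 + t - strip t * (A * gvert v0) = 0"
    by (simp only: act_diff_left act_add_left act_mult act_y t_def[symmetric] act_z)
  then have "(A + strip t - strip t * A) * gvert v0 = 0"
    by (simp only: left_diff_distrib distrib_right mult.assoc strip_mult_gvert[OF t(1)])
  then have "A + strip t - strip t * A = 0"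
    by (rule contrapos_pp) (rule free_algebra_no_zero_divisors[OF _ gen_neq_0])
  then have inv: "U * (1 - A) = 1"
    by (simp add: U_def algebra_simps)
  have "A \<noteq> 0"
    unfolding A_def by (rule free_algebra_no_zero_divisors[OF
          free_algebra_no_zero_divisors[OF gen_neq_0 strip_d] gen_neq_0])
  then obtain w where w: "w \<in> Poly_Mapping.keys A"
    by fastforce
  have "supported (\<lambda>w. w \<noteq> []) A"
    unfolding A_def mult.assoc gen_def[of "Edge e"]
    by (rule supported_mult[where P = "\<lambda>w. w = [Edge e]" and Q = "\<lambda>_. True"])
      (auto simp: supported_def)
  then have w': "letters w \<noteq> []"
    using w by (simp add: supported_def)
  then have "w \<noteq> 0"
    by (auto simp: zero_word_def)
  then have "w \<in> Poly_Mapping.keys (1 - A)"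
    using w by (simp add: in_keys_iff lookup_minus lookup_one)
  from free_algebra_not_left_invertible[OF this w'] inv show False
    by blast
qed

text \<open>The start of any path in the normal form of \<open>x * gvert v\<close> serves as
  \<open>u\<close>: the action of \<open>gvert u\<close> retains the coefficient of that
  path.\<close>

lemma gvert_mult_notin_rel_ideal:
  fixes x :: "('v, 'e, 'k :: field) free_lpa"
  assumes x: "x \<in> carrier F" and v: "v \<in> hverts H" and xv: "x * gvert v \<notin> rel_ideal"
  obtains u where "u \<in> hverts H" "gvert u * x * gvert v \<notin> rel_ideal"
proof -
  define d where "d = act x (gvert v)"
  have d: "d \<approx> x * gvert v" "supported (normal v) d"
    unfolding d_def by (rule normal_form(1)[OF v x], rule normal_form(2)[OF v x])
  have "d \<noteq> 0"
  proof
    assume "d = 0"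
    then have "x * gvert v \<in> rel_ideal"
      using cong_sym[OF d(1)] by (simp add: cong_0_iff)
    then show False
      using xv by contradiction
  qed
  then obtain p where p: "p \<in> Poly_Mapping.keys d"
    by fastforce
  define u where "u = start (letters p)"
  have u: "u \<in> hverts H"
    using p d(2) normal_start by (auto simp: u_def supported_def)
  have "gvert u * x * gvert v \<notin> rel_ideal"
  proof
    assume *: "gvert u * x * gvert v \<in> rel_ideal"
    have "act (gvert u * x * gvert v) (gvert v) = 0"
      by (rule act_rel_ideal[OF * supported_normal_gvert[OF v]])
    moreover have "act (gvert v) (gvert v) = (gvert v :: ('v, 'e, 'k) free_lpa)"
      by (simp add: gen_def act_mon)
    ultimately have "lin (act_gen (Vert u)) d = 0"
      by (simp add: act_mult d_def)
    then have "0 = Poly_Mapping.lookup (lin (act_gen (Vert u)) d) p"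
      by simp
    also have "\<dots> = (\<Sum>w\<in>Poly_Mapping.keys d. if w = p then Poly_Mapping.lookup d w else 0)"
      unfolding lookup_lin by (rule sum.cong) (auto simp: lookup_single when_def u_def)
    also have "\<dots> = Poly_Mapping.lookup d p"
      using p by simp
    finally show False
      using p by (simp add: in_keys_iff)
  qed
  with u show thesis
    by (rule that)
qed

text \<open>Without edges \<open>[Vert v]\<close> is the only irreducible path ending at
  \<open>v\<close>, so \<open>x\<close> multiplies \<open>v\<close> by a scalar
  \<open>b \<noteq> 0\<close>. Dividing by \<open>b\<close> gives an element y that fixes
  \<open>v\<close>; then y + z - z y sends \<open>v\<close> to \<open>v\<close>, whatever z
  is.\<close>

lemma not_quasi_regular_no_edges:
  fixes x :: "('v, 'e, 'k :: field) free_lpa"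
  assumes "edges H = {}" and v: "v \<in> hverts H" and x: "x \<in> carrier F" "x * gvert v \<notin> rel_ideal"
  obtains c where
    "\<forall>z\<in>carrier F. scale c (gvert v) * x + z - z * (scale c (gvert v) * x) \<notin> rel_ideal"
proof -
  define d where "d = act x (gvert v)"
  have d: "d \<approx> x * gvert v" "supported (normal v) d"
    unfolding d_def by (rule normal_form(1)[OF v x(1)], rule normal_form(2)[OF v x(1)])
  have "normal v w \<Longrightarrow> w = [Vert v]" for w
    by (cases rule: normal.cases) (auto simp: assms(1))
  then have keys: "Poly_Mapping.keys d \<subseteq> {Word [Vert v]}"
    using d(2) unfolding supported_def by (metis singletonI subsetI word.collapse)
  define b where "b = Poly_Mapping.lookup d (Word [Vert v])"
  have d_eq: "d = scale b (gvert v)"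
    unfolding b_def using keys
    by (intro poly_mapping_eqI) (auto simp: lookup_scale gen_def lookup_single when_def in_keys_iff)
  have "b \<noteq> 0"
  proof
    assume "b = 0"
    then have "x * gvert v \<in> rel_ideal"
      using cong_sym[OF d(1)] by (simp add: d_eq cong_0_iff)
    then show False
      using x(2) by contradiction
  qed
  let ?y = "scale (inverse b) (gvert v) * x"
  have y: "act ?y (gvert v) = gvert v"
  proof -
    have "act ?y (gvert v) = scale (inverse b) (act (gvert v) d)"
      by (simp only: mult.assoc act_mult[of "gvert v"] act_scale_left d_def)
    also have "\<dots> = scale (inverse b * b) (act (gvert v) (gvert v))"
      unfolding d_eq act_scale by (simp add: mult.assoc[symmetric] mult_single)
    also have "\<dots> = gvert v"
      using \<open>b \<noteq> 0\<close> by (simp add: gen_def act_mon)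
    finally show ?thesis .
  qed
  show thesis
  proof (rule that[of "inverse b"], intro ballI notI)
    fix z :: "('v, 'e, 'k) free_lpa"
    assume "?y + z - z * ?y \<in> rel_ideal"
    from act_rel_ideal[OF this supported_normal_gvert[OF v]]
    have "gvert v + act z (gvert v) - act z (gvert v) = (0 :: ('v, 'e, 'k) free_lpa)"
      by (simp only: act_diff_left act_add_left act_mult[of z] y)
    then show False
      by (simp add: gen_neq_0)
  qed
qed

text \<open>The finitely many end vertices of the words of \<open>x\<close>, collected in
  \<open>W\<close>, add up to a local right unit for \<open>x\<close>, so some
  \<open>x * gvert v\<close> is nonzero modulo the ideal.\<close>

lemma right_local:
  fixes x :: "('v, 'e, 'k :: field) free_lpa"
  assumes x: "x \<in> carrier F" "x \<notin> rel_ideal"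
  obtains v where "v \<in> hverts H" "x * gvert v \<notin> rel_ideal"
proof (rule ccontr)
  assume "\<not> thesis"
  with that have all: "x * gvert v \<in> rel_ideal" if "v \<in> hverts H" for v
    using \<open>v \<in> hverts H\<close> by blast
  define W where "W = (\<lambda>w. finish (last (letters w))) ` Poly_Mapping.keys x"
  let ?P = "\<lambda>w. w \<noteq> [] \<and> set w \<subseteq> generators H \<and> finish (last w) \<in> W"
  have P: "supported ?P x"
    using x(1) by (auto simp: carrier_free_algebra supported_def W_def)
  have W: "finite W" "W \<subseteq> hverts H"
    using x(1) finish_generator last_in_set
    by (auto simp: W_def carrier_free_algebra supported_def)
  have *: "(\<Sum>v\<in>W. mon w * gvert v) \<approx> (mon w :: ('v, 'e, 'k) free_lpa)" if w: "?P w" for w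
  proof -
    have "(\<Sum>v\<in>W. mon w * gvert v - (if v = finish (last w) then mon w else (0 :: ('v, 'e, 'k) free_lpa))) \<in> rel_ideal"
      using mon_mult_gvert[of _ w] w W(2) unfolding cong_def by (intro sum_rel_ideal) blast
    then show ?thesis
      using w W(1) by (simp add: sum_subtractf cong_def)
  qed
  have "lin (\<lambda>w. \<Sum>v\<in>W. mon w * gvert v) x \<approx> lin mon x"
    by (rule lin_cong_ideal[OF P *])
  then have "lin (\<lambda>w. \<Sum>v\<in>W. mon w * gvert v) x \<approx> x"
    unfolding lin_mon .
  moreover have "lin (\<lambda>w. \<Sum>v\<in>W. mon w * gvert v) x = (\<Sum>v\<in>W. x * gvert v)"
    by (simp only: sum_distrib_left[symmetric] lin_mon_mult)
  moreover have "(\<Sum>v\<in>W. x * gvert v) \<in> rel_ideal" (is "?s \<in> _")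
    using all W(2) by (intro sum_rel_ideal) auto
  ultimately have "?s \<approx> x" "?s \<in> rel_ideal"
    by simp_all
  then have "x \<in> rel_ideal"
    using cong_in_rel_ideal_iff[of ?s x] by simp
  then show False
    using x(2) by contradiction
qed

end

section \<open>Marks adapted to an edge, and transport along walks\<close>

locale thick_hypergraph = listed_hypergraph H \<sigma> \<rho>
  for H :: "('v, 'e) hypergraph" and \<sigma> \<rho> :: "'e \<Rightarrow> 'v list" +
  assumes thick: "h \<in> hedges H \<Longrightarrow> 2 \<le> length (listing s h)"
begin

text \<open>
  The algebra does not depend on the marks, so they can be chosen to avoid both indices of a
  given edge.
\<close>

lemma marked_hypergraph_avoiding:
  "marked_hypergraph H \<sigma> \<rho> (\<lambda>s h. if a s = 0 then 1 else 0)"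
proof
  \<comment> \<open>Both 0 and 1 are positions in every listing, as each has at least two entries;
    the value chosen differs from \<open>a s\<close>.\<close>
  show "(if a s = 0 then 1 else 0) < length (listing s h)" if "h \<in> hedges H" for s h
    using thick[OF that, of s] by auto
qed

lemma gedge_mult_notin_rel_ideal:
  fixes x :: "('v, 'e, 'k :: field) free_lpa"
  assumes "v \<in> hverts H" "local_at u v x" "x \<notin> rel_ideal" "ehead e = u"
  shows "gedge e * x \<notin> rel_ideal"
proof -
  \<comment> \<open>Only the head index of \<open>e\<close> must be avoided; the \<open>0\<close>
    for the other side is arbitrary.\<close>
  interpret marked_hypergraph H \<sigma> \<rho> "\<lambda>s h. if (\<lambda>s. if s = sg e then 0 else ri e) s = 0 then 1 else 0"
    by (rule marked_hypergraph_avoiding)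
  show ?thesis
    by (rule gedge_mult_notin_rel_ideal_right_free[OF assms]) simp
qed

lemma not_quasi_regular_sandwich:
  fixes x z :: "('v, 'e, 'k :: field) free_lpa"
  assumes "v \<in> hverts H" "local_at v v x" "x \<notin> rel_ideal" "e \<in> edges H" "ehead e = v" "z \<in> carrier F"
  defines "y \<equiv> gedge e * x * gedge (mk_edge (\<not> sg e) (hy e) (ri e) (li e))"
  shows "y + z - z * y \<notin> rel_ideal"
proof -
  \<comment> \<open>The two indices of \<open>e\<close> belong to opposite sides, so one mark per
    side avoids both.\<close>
  interpret marked_hypergraph H \<sigma> \<rho> "\<lambda>s h. if (\<lambda>s. if s = sg e then li e else ri e) s = 0 then 1 else 0"
    by (rule marked_hypergraph_avoiding)
  show ?thesis
    unfolding y_def by (rule not_quasi_regular[OF assms(1-5) _ _ assms(6)]) simp_all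
qed

text \<open>Left multiplication by the edges of the walk, the last one first, moves the start of
  \<open>x\<close> back to \<open>a\<close>. Every edge may use its own marks, since
  \<open>gedge_mult_notin_rel_ideal\<close> does not mention any.\<close>

lemma local_at_walk:
  fixes x :: "('v, 'e, 'k :: field) free_lpa"
  assumes "pre_digraph.cas (edge_digraph H \<sigma> \<rho>) a p u" "set p \<subseteq> edges H"
    and "v \<in> hverts H" "local_at u v x" "x \<notin> rel_ideal" "x \<in> J"
    and J: "\<And>a x. a \<in> carrier F \<Longrightarrow> x \<in> J \<Longrightarrow> a * x \<in> J"
  obtains x' where "local_at a v x'" "x' \<notin> rel_ideal" "x' \<in> J"
  using assms(1,2)
proof (induction p arbitrary: a thesis)
  case Nil
  then show ?case
    using assms(4-6) by (simp add: pre_digraph.cas.simps)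
next
  case (Cons e p)
  have ends: "tail (edge_digraph H \<sigma> \<rho>) e = etail e" "head (edge_digraph H \<sigma> \<rho>) e = ehead e"
    by (cases e; simp add: edge_digraph_def etail_def ehead_def listing_def)+
  have e: "e \<in> edges H" and a: "a = etail e"
    using Cons.prems(2,3) by (auto simp: pre_digraph.cas.simps ends)
  obtain x' where x': "local_at (ehead e) v x'" "x' \<notin> rel_ideal" "x' \<in> J"
    using Cons.IH[of "ehead e"] Cons.prems(2,3) by (auto simp: pre_digraph.cas.simps ends)
  show ?case
    by (rule Cons.prems(1)[of "gedge e * x'", unfolded a])
      (rule gedge_mult_local_at[OF x'(1) e refl] gedge_mult_notin_rel_ideal[OF assms(3) x'(1,2) refl]
        J[OF gedge_in_F[OF e] x'(3)])+
qed

text \<open>A trivial walk has no last edge; the given edge \<open>e\<close> ending at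
  \<open>u\<close> then serves.\<close>

lemma walk_last_edge:
  assumes "pre_digraph.cas (edge_digraph H \<sigma> \<rho>) u p v" "set p \<subseteq> edges H"
    and "e \<in> edges H" "ehead e = u"
  shows "\<exists>f\<in>edges H. ehead f = v"
  using assms
proof (induction p arbitrary: u e)
  case Nil
  then show ?case
    by (auto simp: pre_digraph.cas.simps)
next
  case (Cons f p)
  have "head (edge_digraph H \<sigma> \<rho>) f = ehead f"
    by (cases f) (simp_all add: edge_digraph_def ehead_def listing_def)
  then show ?case
    using Cons.IH[OF _ _ _ refl, of f] Cons.prems by (simp add: pre_digraph.cas.simps)
qed

text \<open>The core of the theorem, phrased for the preimage \<open>J\<close> of an ideal so that
  the whole argument stays in the free algebra.\<close>

lemma quasi_regular_ideal_subset:
  fixes J :: "('v, 'e, 'k :: field) free_lpa set"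
  assumes conn: "hconnected H \<sigma> \<rho>"
    and JF: "J \<subseteq> carrier F"
    and J: "\<And>a x. a \<in> carrier F \<Longrightarrow> x \<in> J \<Longrightarrow> a * x \<in> J" "\<And>a x. a \<in> carrier F \<Longrightarrow> x \<in> J \<Longrightarrow> x * a \<in> J"
    and qr: "\<And>y. y \<in> J \<Longrightarrow> \<exists>z\<in>carrier F. y + z - z * y \<in> rel_ideal"
  shows "J \<subseteq> rel_ideal"
proof (rule ccontr)
  assume "\<not> J \<subseteq> rel_ideal"
  then obtain x where x: "x \<in> J" "x \<in> carrier F" "x \<notin> rel_ideal"
    using JF by blast
  \<comment> \<open>Any marks will do here: the facts about \<open>x\<close> used below do not refer
    to a particular edge.\<close>
  interpret marked_hypergraph H \<sigma> \<rho> "\<lambda>s h. if (\<lambda>_. 0) s = 0 then 1 else 0"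
    by (rule marked_hypergraph_avoiding)
  obtain v where v: "v \<in> hverts H" "x * gvert v \<notin> rel_ideal"
    using right_local[OF x(2,3)] .
  show False
  proof (cases "edges H = {}")
    case True
    obtain c where c: "\<forall>z\<in>carrier F. scale c (gvert v) * x + z - z * (scale c (gvert v) * x) \<notin> rel_ideal"
      using not_quasi_regular_no_edges[OF True v(1) x(2) v(2)] .
    have "scale c (gvert v) * x \<in> J"
      by (rule J(1)[OF free_algebra_closed(5)[OF gvert_in_F[OF v(1)]] x(1)])
    from qr[OF this] c show False
      by blast
  next
    case False
    then obtain e where e: "e \<in> edges H"
      by blast
    have walk: "\<exists>p. pre_digraph.cas (edge_digraph H \<sigma> \<rho>) a p b \<and> set p \<subseteq> edges H"
      if "a \<in> hverts H" "b \<in> hverts H" for a b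
      using conn that unfolding hconnected_def pre_digraph.awalk_def
      by (fastforce simp: edge_digraph_def)
    obtain f where f: "f \<in> edges H" "ehead f = v"
      using walk[OF ehead_in_hverts[OF e] v(1)] walk_last_edge[OF _ _ e refl] by metis
    obtain u where u: "u \<in> hverts H" "gvert u * x * gvert v \<notin> rel_ideal"
      using gvert_mult_notin_rel_ideal[OF x(2) v] .
    have loc: "local_at u v (gvert u * x * gvert v)"
      by (rule local_at_gvert_mult[OF u(1) v(1) x(2)])
    have inJ: "gvert u * x * gvert v \<in> J"
      by (intro J x gvert_in_F u v)
    \<comment> \<open>The element found so far lies in the corner u L v; putting a walk from
      \<open>v\<close> to \<open>u\<close> in front of it leads to v L v.\<close>
    obtain p where p: "pre_digraph.cas (edge_digraph H \<sigma> \<rho>) v p u" "set p \<subseteq> edges H"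
      using walk[OF v(1) u(1)] by blast
    obtain x' where x': "local_at v v x'" "x' \<notin> rel_ideal" "x' \<in> J"
      using local_at_walk[OF p v(1) loc u(2) inJ J(1)] by blast
    have "mk_edge (\<not> sg f) (hy f) (ri f) (li f) \<in> edges H"
      using f(1) by (simp add: mk_edge_in_edges_iff in_edges_iff[of f])
    then have "gedge f * x' * gedge (mk_edge (\<not> sg f) (hy f) (ri f) (li f)) \<in> J"
      by (intro J gedge_in_F f x')
    from qr[OF this] not_quasi_regular_sandwich[OF v(1) x'(1,2) f] show False
      by blast
  qed
qed

end

section \<open>The quotient\<close>

context listed_hypergraph
begin

abbreviation coset :: "('v, 'e, 'k :: field) free_lpa \<Rightarrow> ('v, 'e, 'k) free_lpa set" where
  "coset x \<equiv> rel_ideal +>\<^bsub>F\<^esub> x"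

lemma mem_coset: "y \<in> coset x \<longleftrightarrow> y \<approx> x"
  by (force simp: a_r_coset_def r_coset_def cong_def)

lemma coset_eq_iff: "coset x = coset y \<longleftrightarrow> x \<approx> y"
proof
  assume "coset x = coset y"
  then show "x \<approx> y"
    using mem_coset[of x x] mem_coset[of x y] by simp
next
  assume "x \<approx> y"
  then show "coset x = coset y"
    by (auto simp: mem_coset intro: cong_trans cong_trans[OF _ cong_sym])
qed

lemma coset_0: "coset 0 = rel_ideal"
  by (auto simp: mem_coset cong_0_iff)

lemma cong_in_F:
  assumes "x \<in> carrier F" "y \<approx> x"
  shows "y \<in> carrier F"
  using free_algebra_closed(2)[OF subsetD[OF rel_ideal_in_F assms(2)[unfolded cong_def]] assms(1)]
  by simp

lemma leavitt_path_algebra_eq: "leavitt_path_algebra H \<sigma> \<rho> = quot_algebra F rel_ideal"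
  by (simp add: leavitt_path_algebra_def rel_ideal_def relations_def Let_def)

lemma lpa_carrier:
  "carrier (leavitt_path_algebra H \<sigma> \<rho> :: ('k :: field, ('v, 'e, 'k) free_lpa set) module) =
    coset ` carrier F"
  by (auto simp: leavitt_path_algebra_eq quot_algebra_def ring.defs FactRing_def A_RCOSETS_def'
      a_r_coset_def r_coset_def)

lemma lpa_zero: "zero (leavitt_path_algebra H \<sigma> \<rho>) = coset 0"
  by (simp add: leavitt_path_algebra_eq quot_algebra_def ring.defs FactRing_def coset_0)

lemma lpa_add: "add (leavitt_path_algebra H \<sigma> \<rho>) (coset x) (coset y) = coset (x + y)"
proof -
  have "z \<in> coset x <+>\<^bsub>F\<^esub> coset y \<longleftrightarrow> z \<in> coset (x + y)" for z
  proof
    assume "z \<in> coset x <+>\<^bsub>F\<^esub> coset y"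
    then obtain a b where "a \<approx> x" "b \<approx> y" "z = a + b"
      by (auto simp: set_add_def' mem_coset)
    then show "z \<in> coset (x + y)"
      by (simp add: mem_coset cong_add)
  next
    assume "z \<in> coset (x + y)"
    then have "z - y \<in> coset x" "y \<in> coset y"
      by (simp_all add: mem_coset cong_def algebra_simps zero_rel_ideal)
    moreover have "z = (z - y) + y"
      by simp
    ultimately show "z \<in> coset x <+>\<^bsub>F\<^esub> coset y"
      unfolding set_add_def' free_algebra_simps by blast
  qed
  then show ?thesis
    by (simp add: leavitt_path_algebra_eq quot_algebra_def ring.defs FactRing_def set_eq_iff)
qed

text \<open>The product of cosets is a union over all representatives. These stay in
  \<open>F\<close>, where congruence is stable under multiplication, so all members of the union
  coincide.\<close>

lemma lpa_mult:
  assumes "x \<in> carrier F" "y \<in> carrier F"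
  shows "mult (leavitt_path_algebra H \<sigma> \<rho>) (coset x) (coset y) = coset (x * y)"
proof -
  have eq: "coset (a * b) = coset (x * y)" if "a \<in> coset x" "b \<in> coset y" for a b
    unfolding coset_eq_iff using that unfolding mem_coset
    by (meson assms cong_in_F cong_mult_left cong_mult_right cong_trans)
  have "(\<Union>a\<in>coset x. \<Union>b\<in>coset y. coset (a * b)) = (\<Union>a\<in>coset x. \<Union>b\<in>coset y. coset (x * y))"
    by (intro SUP_cong refl eq)
  also have "\<dots> = coset (x * y)"
  proof -
    have "coset x \<noteq> {}" "coset y \<noteq> {}"
      using mem_coset[of x x] mem_coset[of y y] by (metis cong_refl empty_iff)+
    then show ?thesis
      by (simp only: UN_constant if_False)
  qed
  finally show ?thesis
    by (simp add: leavitt_path_algebra_eq quot_algebra_def ring.defs FactRing_def rcoset_mult_def)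
qed

lemma ring_ideal_zero:
  "ring_ideal {coset 0} (leavitt_path_algebra H \<sigma> \<rho> :: ('k :: field, ('v, 'e, 'k) free_lpa set) module)"
    (is "ring_ideal _ ?L")
proof -
  \<comment> \<open>The quotient is used as a bare record, so the inverse of its zero is computed
    from the definite description.\<close>
  have "inv\<^bsub>add_monoid ?L\<^esub> (coset 0) = coset 0"
    unfolding m_inv_def
  proof (rule the_equality)
    fix Y
    assume "Y \<in> carrier (add_monoid ?L) \<and> coset 0 \<otimes>\<^bsub>add_monoid ?L\<^esub> Y = \<one>\<^bsub>add_monoid ?L\<^esub> \<and>
      Y \<otimes>\<^bsub>add_monoid ?L\<^esub> coset 0 = \<one>\<^bsub>add_monoid ?L\<^esub>"
    then show "Y = coset 0"
      by (auto simp: lpa_carrier lpa_add lpa_zero)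
  qed (simp add: lpa_carrier lpa_add lpa_zero free_algebra_closed)
  then have "additive_subgroup {coset 0} ?L"
    by (intro additive_subgroup.intro subgroup.intro)
      (auto simp: lpa_carrier lpa_add lpa_zero free_algebra_closed)
  then show ?thesis
    by (auto simp: ring_ideal_def lpa_carrier lpa_mult free_algebra_closed)
qed

text \<open>The zero ideal is quasi-regular, and showing that it contains every quasi-regular ideal
  proves at once that a greatest one exists and what it is. An ideal of the quotient is replaced by
  its preimage \<open>J'\<close> in \<open>F\<close>.\<close>

lemma semiprimitiveI:
  assumes "\<And>J :: ('v, 'e, 'k :: field) free_lpa set. J \<subseteq> carrier F \<Longrightarrow>
      (\<And>a x. a \<in> carrier F \<Longrightarrow> x \<in> J \<Longrightarrow> a * x \<in> J) \<Longrightarrow>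
      (\<And>a x. a \<in> carrier F \<Longrightarrow> x \<in> J \<Longrightarrow> x * a \<in> J) \<Longrightarrow>
      (\<And>y. y \<in> J \<Longrightarrow> \<exists>z\<in>carrier F. y + z - z * y \<in> rel_ideal) \<Longrightarrow> J \<subseteq> rel_ideal"
  shows "semiprimitive (leavitt_path_algebra H \<sigma> \<rho> :: ('k, ('v, 'e, 'k) free_lpa set) module)"
    (is "semiprimitive ?L")
  unfolding semiprimitive_def jacobson_radical_def lpa_zero
proof (rule Greatest_equality)
  have "left_quasi_regular ?L (coset 0)"
    unfolding left_quasi_regular_def
    by (rule bexI[of _ "coset 0"]) (simp_all add: lpa_carrier lpa_add lpa_mult free_algebra_closed)
  then show "ring_ideal {coset 0} ?L \<and> (\<forall>x\<in>{coset 0}. left_quasi_regular ?L x)"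
    using ring_ideal_zero by simp
next
  fix J
  assume J: "ring_ideal J ?L \<and> (\<forall>x\<in>J. left_quasi_regular ?L x)"
  define J' where "J' = {x \<in> carrier F. coset x \<in> J}"
  have sub: "J \<subseteq> carrier ?L"
    using J subgroup.subset[of J "add_monoid ?L"]
    by (simp add: ring_ideal_def additive_subgroup_def)
  have mult: "A \<otimes>\<^bsub>?L\<^esub> X \<in> J" "X \<otimes>\<^bsub>?L\<^esub> A \<in> J" if "X \<in> J" "A \<in> carrier ?L" for A X
    using J that by (auto simp: ring_ideal_def)
  have "J' \<subseteq> rel_ideal"
  proof (rule assms)
    show "a * x \<in> J'" "x * a \<in> J'" if "a \<in> carrier F" "x \<in> J'" for a x
      using that mult[of "coset x" "coset a"]
      by (simp_all add: J'_def lpa_carrier lpa_mult free_algebra_closed)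
    show "\<exists>z\<in>carrier F. y + z - z * y \<in> rel_ideal" if "y \<in> J'" for y
    proof -
      have y: "y \<in> carrier F" "left_quasi_regular ?L (coset y)"
        using that J by (auto simp: J'_def)
      then obtain z where z: "z \<in> carrier F" "coset y \<oplus>\<^bsub>?L\<^esub> coset z = coset z \<otimes>\<^bsub>?L\<^esub> coset y"
        by (auto simp: left_quasi_regular_def lpa_carrier)
      then have "y + z \<approx> z * y"
        using y(1) by (simp add: lpa_add lpa_mult coset_eq_iff)
      then show ?thesis
        using z(1) unfolding cong_def by blast
    qed
  qed (auto simp: J'_def)
  show "J \<subseteq> {coset 0}"
  proof
    fix X assume X: "X \<in> J"
    then obtain x where x: "x \<in> carrier F" "X = coset x"
      using sub by (auto simp: lpa_carrier)
    with X \<open>J' \<subseteq> rel_ideal\<close> have "x \<in> rel_ideal"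
      by (auto simp: J'_def)
    then have "x \<approx> 0"
      by (simp add: cong_0_iff)
    then show "X \<in> {coset 0}"
      unfolding x(2) using coset_eq_iff by blast
  qed
qed

end

theorem corollary45:
  fixes H :: "('v, 'e) hypergraph"
    and \<sigma> \<rho> :: "'e \<Rightarrow> 'v list"
  assumes "hypergraph H"
    and "listings H \<sigma> \<rho>"
    and "hconnected H \<sigma> \<rho>"
    and "\<And>h. h \<in> hedges H \<Longrightarrow> size (src H h) \<ge> 2 \<and> size (rng H h) \<ge> 2"
  shows "semiprimitive
           (leavitt_path_algebra H \<sigma> \<rho> :: ('k :: field, ('v, 'e, 'k) free_lpa set) module)"
proof -
  interpret listed_hypergraph H \<sigma> \<rho>
    by (rule listed_hypergraph.intro) fact+
  interpret thick_hypergraph H \<sigma> \<rho>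
  proof
    show "2 \<le> length (listing s h)" if "h \<in> hedges H" for h s
      using assms(4)[OF that] size_src_rng[OF that] by (cases s) simp_all
  qed
  show ?thesis
    by (rule semiprimitiveI) (rule quasi_regular_ideal_subset[OF assms(3)])
qed

end
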